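(* Consider the source coding problem with receiver side information described in the context, let $\mathcal{R}$ be its set of achievable rate triples, and let $\mathcal{R}_{in}$ be as defined in the context. Then $\mathcal{R}\supseteq\mathcal{R}_{in}$.
   Context: Let $\mathcal{X},\mathcal{Y},\mathcal{U},\mathcal{V}$ be finite sets and let $\{(X_i,Y_i,U_i,V_i)\}_{i\ge1}$ be i.i.d. with joint distribution $\mathcal{Q}_{XYUV}$. For $i=0,1,2$ let $\mathcal{M}_i=\{1,\dots,|\mathcal{M}_i|\}$ be finite index sets. A code of block length $n$ consists of an encoder $e^{(n)}:\mathcal{X}^n\times\mathcal{Y}^n\to\mathcal{M}_0\times\mathcal{M}_1\times\mathcal{M}_2$, $(M_0,M_1,M_2)=e^{(n)}(X^n,Y^n)$, a decoder $d_x^{(n)}:\mathcal{M}_0\times\mathcal{M}_1\times\mathcal{U}^n\to\mathcal{X}^n$, $\widehat X^n=d_x^{(n)}(M_0,M_1,U^n)$, and a decoder $d_y^{(n)}:\mathcal{M}_0\times\mathcal{M}_2\times\mathcal{V}^n\to\mathcal{Y}^n$, $\widehat Y^n=d_y^{(n)}(M_0,M_2,V^n)$. Let $P_e=\max\{\Pr[\widehat X^n\ne X^n],\Pr[\widehat Y^n\ne Y^n]\}$. A triple $(R_0,R_1,R_2)$ is achievable if for every $\epsilon>0$ and all sufficiently large $n$ there is such a code with $P_e\le\epsilon$ and $(1/n)\log_2|\mathcal{M}_i|\le R_i+\epsilon$, $i=0,1,2$; $\mathcal{R}$ is the set of achievable triples. Let $\mathcal{W}$ be a finite set with $|\mathcal{W}|\le|\mathcal{X}||\mathcal{Y}|+3$,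 and let $\mathcal{P}$ be the family of probability functions $p$ on $\mathcal{W}\times\mathcal{X}\times\mathcal{Y}\times\mathcal{U}\times\mathcal{V}$ with $p(w,x,y,u,v)=p(w|x,y)p(x,y,u,v)$ and $\sum_w p(w,x,y,u,v)=\mathcal{Q}_{XYUV}(x,y,u,v)$. For $p\in\mathcal{P}$ let $\mathcal{R}_{in}^{(p)}$ be the set of $(R_0,R_1,R_2)$ with $R_0\ge\max\{I_p(X,Y;W|U),I_p(X,Y;W|V)\}$, $R_1\ge H_p(X|W,U)$, $R_2\ge H_p(Y|W,V)$, and let $\mathcal{R}_{in}$ be the closure of $\bigcup_{p\in\mathcal{P}}\mathcal{R}_{in}^{(p)}$. *)

theory Defs
  imports "HOL-Analysis.Analysis" "HOL-Probability.Probability_Mass_Function"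
begin

text \<open>p is a probability function on a finite sample space; f, g, h are random variables
  (functions of the outcome). Entropy uses the convention 0 log 0 = 0 (automatic, since
  the summand is q * log 2 q and q = 0 gives 0).\<close>

definition ent :: "('o::finite \<Rightarrow> real) \<Rightarrow> ('o \<Rightarrow> 'z) \<Rightarrow> real" where
  "ent p f = - (\<Sum>z\<in>f ` UNIV. (\<Sum>\<omega>\<in>{\<omega>. f \<omega> = z}. p \<omega>) * log 2 (\<Sum>\<omega>\<in>{\<omega>. f \<omega> = z}. p \<omega>))"

definition cent :: "('o::finite \<Rightarrow> real) \<Rightarrow> ('o \<Rightarrow> 'z) \<Rightarrow> ('o \<Rightarrow> 'b) \<Rightarrow> real" where
  "cent p f g = ent p (\<lambda>\<omega>. (f \<omega>, g \<omega>)) - ent p g"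

definition cmi :: "('o::finite \<Rightarrow> real) \<Rightarrow> ('o \<Rightarrow> 'z) \<Rightarrow> ('o \<Rightarrow> 'b) \<Rightarrow> ('o \<Rightarrow> 'c) \<Rightarrow> real" where
  "cmi p f g h = cent p f h - cent p f (\<lambda>\<omega>. (g \<omega>, h \<omega>))"

definition iid_prob :: "'a pmf \<Rightarrow> 'a list \<Rightarrow> real" where
  "iid_prob Q zs = prod_list (map (pmf Q) zs)"

definition is_code :: "nat \<Rightarrow> nat \<Rightarrow> nat \<Rightarrow> nat \<Rightarrow> ('x list \<Rightarrow> 'y list \<Rightarrow> nat \<times> nat \<times> nat) \<Rightarrow> bool" where
  "is_code n m0 m1 m2 e \<longleftrightarrow>
     (\<forall>xs ys. length xs = n \<longrightarrow> length ys = n \<longrightarrow>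
        fst (e xs ys) \<in> {1..m0} \<and> fst (snd (e xs ys)) \<in> {1..m1} \<and> snd (snd (e xs ys)) \<in> {1..m2})"

definition err_x :: "('x::finite \<times> 'y::finite \<times> 'u::finite \<times> 'v::finite) pmf \<Rightarrow> nat \<Rightarrow>
    ('x list \<Rightarrow> 'y list \<Rightarrow> nat \<times> nat \<times> nat) \<Rightarrow> (nat \<Rightarrow> nat \<Rightarrow> 'u list \<Rightarrow> 'x list) \<Rightarrow> real" where
  "err_x Q n e dx = (\<Sum>zs\<in>{zs. length zs = n}.
     (let xs = map fst zs; ys = map (fst \<circ> snd) zs; us = map (fst \<circ> snd \<circ> snd) zs;
          (a, b, c) = e xs ys
      in if dx a b us \<noteq> xs then iid_prob Q zs else 0))"

definition err_y :: "('x::finite \<times> 'y::finite \<times> 'u::finite \<times> 'v::finite) pmf \<Rightarrow> nat \<Rightarrow>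
    ('x list \<Rightarrow> 'y list \<Rightarrow> nat \<times> nat \<times> nat) \<Rightarrow> (nat \<Rightarrow> nat \<Rightarrow> 'v list \<Rightarrow> 'y list) \<Rightarrow> real" where
  "err_y Q n e dy = (\<Sum>zs\<in>{zs. length zs = n}.
     (let xs = map fst zs; ys = map (fst \<circ> snd) zs; vs = map (snd \<circ> snd \<circ> snd) zs;
          (a, b, c) = e xs ys
      in if dy a c vs \<noteq> ys then iid_prob Q zs else 0))"

definition achievable :: "('x::finite \<times> 'y::finite \<times> 'u::finite \<times> 'v::finite) pmf \<Rightarrow> real \<times> real \<times> real \<Rightarrow> bool" where
  "achievable Q R \<longleftrightarrow> (case R of (R0, R1, R2) \<Rightarrow>
     (\<forall>\<epsilon>>0. \<exists>N. \<forall>n\<ge>N. \<exists>m0 m1 m2 e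
        (dx :: nat \<Rightarrow> nat \<Rightarrow> 'u list \<Rightarrow> 'x list) (dy :: nat \<Rightarrow> nat \<Rightarrow> 'v list \<Rightarrow> 'y list).
        is_code n m0 m1 m2 e \<and>
        max (err_x Q n e dx) (err_y Q n e dy) \<le> \<epsilon> \<and>
        log 2 (real m0) / real n \<le> R0 + \<epsilon> \<and>
        log 2 (real m1) / real n \<le> R1 + \<epsilon> \<and>
        log 2 (real m2) / real n \<le> R2 + \<epsilon>))"

definition cond_kernels :: "('x \<Rightarrow> 'y \<Rightarrow> 'w::finite \<Rightarrow> real) set" where
  "cond_kernels = {c. (\<forall>x y w. 0 \<le> c x y w) \<and> (\<forall>x y. (\<Sum>w\<in>UNIV. c x y w) = 1)}"

definition joint_p :: "('x \<Rightarrow> 'y \<Rightarrow> 'w \<Rightarrow> real) \<Rightarrow> ('x \<times> 'y \<times> 'u \<times> 'v) pmf \<Rightarrow>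
    ('w \<times> 'x \<times> 'y \<times> 'u \<times> 'v \<Rightarrow> real)" where
  "joint_p c Q = (\<lambda>(w, x, y, u, v). c x y w * pmf Q (x, y, u, v))"

definition Rin_p :: "('w::finite \<times> 'x::finite \<times> 'y::finite \<times> 'u::finite \<times> 'v::finite \<Rightarrow> real) \<Rightarrow> (real \<times> real \<times> real) set" where
  "Rin_p p = {(R0, R1, R2).
     R0 \<ge> max (cmi p (\<lambda>(w,x,y,u,v). (x,y)) (\<lambda>(w,x,y,u,v). w) (\<lambda>(w,x,y,u,v). u))
                (cmi p (\<lambda>(w,x,y,u,v). (x,y)) (\<lambda>(w,x,y,u,v). w) (\<lambda>(w,x,y,u,v). v)) \<and>
     R1 \<ge> cent p (\<lambda>(w,x,y,u,v). x) (\<lambda>(w,x,y,u,v). (w,u)) \<and>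
     R2 \<ge> cent p (\<lambda>(w,x,y,u,v). y) (\<lambda>(w,x,y,u,v). (w,v))}"

end

theory Submission
  imports Defs "HOL-Probability.Product_PMF" "HOL-Probability.Information"
begin

text \<open>
  Draw \<open>W\<^sup>n\<close> from the kernel \<open>p(w|x,y)\<close> and hash it twice, \<open>F = F(W\<^sup>n)\<close> and \<open>M\<^sub>0 = G(W\<^sup>n)\<close>.
  If the rate of \<open>F\<close> is just below \<open>H(W|X,Y)\<close>, the leftover hash lemma makes \<open>F\<close> almost uniform
  and independent of \<open>(X\<^sup>n,Y\<^sup>n)\<close>, so \<open>F\<close> may be replaced by a constant known to everybody. If the joint
  rate of \<open>(F,G)\<close> exceeds \<open>H(W|U)\<close> and \<open>H(W|V)\<close>, each receiver recovers \<open>W\<^sup>n\<close> from \<open>(F,M\<^sub>0)\<close> and its side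
  information. Hence \<open>M\<^sub>0\<close> only costs the rate \<open>max {H(W|U), H(W|V)} - H(W|X,Y)\<close>, which is
  \<open>max {I(X,Y;W|U), I(X,Y;W|V)}\<close> because \<open>(U,V)\<close> and \<open>W\<close> are conditionally independent given \<open>(X,Y)\<close>.
  Knowing \<open>W\<^sup>n\<close>, the receivers decode \<open>X\<^sup>n\<close> and \<open>Y\<^sup>n\<close> from hashes of rates \<open>H(X|W,U)\<close> and \<open>H(Y|W,V)\<close>.
\<close>

section \<open>Finitely supported distributions\<close>

lemma expectation_of_bool_pmf: "(\<integral>x. of_bool (P x) \<partial>measure_pmf p) = measure p {x. P x}"
proof -
  have "(\<integral>x. indicator {x. P x} x \<partial>measure_pmf p) = measure p {x. P x}"
    by (simp only: Bochner_Integration.integral_indicator space_measure_pmf Int_UNIV_right)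
  then show ?thesis by (simp add: indicator_def)
qed

lemma expectation_bind_pmf:
  fixes h :: "'b \<Rightarrow> 'c::{banach, second_countable_topology}"
  assumes "finite (set_pmf p)" and "\<And>x. x \<in> set_pmf p \<Longrightarrow> finite (set_pmf (f x))"
  shows "(\<integral>y. h y \<partial>bind_pmf p f) = (\<integral>x. (\<integral>y. h y \<partial>f x) \<partial>p)"
proof -
  have "(\<integral>y. h y \<partial>bind_pmf p f) = (\<Sum>x\<in>set_pmf p. pmf p x *\<^sub>R (\<integral>y. h y \<partial>f x))"
    using assms by (intro pmf_expectation_bind) auto
  also have "\<dots> = (\<integral>x. (\<integral>y. h y \<partial>f x) \<partial>p)"
    using assms by (intro integral_measure_pmf[symmetric])
  finally show ?thesis .
qed

lemma expectation_pair_pmf: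
  fixes h :: "'a \<times> 'b \<Rightarrow> 'c::{banach, second_countable_topology}"
  assumes "finite (set_pmf p)" and "finite (set_pmf q)"
  shows "(\<integral>z. h z \<partial>pair_pmf p q) = (\<integral>x. (\<integral>y. h (x, y) \<partial>q) \<partial>p)"
  using assms by (simp add: pair_pmf_def expectation_bind_pmf)

lemma prob_pair_pmf:
  assumes "finite (set_pmf p)" and "finite (set_pmf q)"
  shows "measure (pair_pmf p q) {(x, y). R x y} = (\<integral>x. measure q {y. R x y} \<partial>p)"
  using expectation_pair_pmf[OF assms, of "\<lambda>(x, y). of_bool (R x y) :: real"]
  by (simp add: case_prod_unfold expectation_of_bool_pmf)

lemma expectation_swap_pmf:
  fixes h :: "'a \<Rightarrow> 'b \<Rightarrow> 'c::{banach, second_countable_topology}"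
  assumes "finite (set_pmf p)" and "finite (set_pmf q)"
  shows "(\<integral>x. (\<integral>y. h x y \<partial>q) \<partial>p) = (\<integral>y. (\<integral>x. h x y \<partial>p) \<partial>q)"
  using expectation_pair_pmf[OF assms, of "case_prod h"]
    expectation_pair_pmf[OF assms(2,1), of "\<lambda>(y, x). h x y"]
  by (subst (asm) pair_commute_pmf) (simp add: case_prod_unfold)

lemma expectation_prob_swap_pmf:
  assumes "finite (set_pmf p)" and "finite (set_pmf q)"
  shows "(\<integral>x. measure q {y. R x y} \<partial>p) = (\<integral>y. measure p {x. R x y} \<partial>q)"
  unfolding expectation_of_bool_pmf[symmetric] by (rule expectation_swap_pmf[OF assms])

lemma expectation_mono_pmf:
  fixes f g :: "'a \<Rightarrow> real"
  assumes "finite (set_pmf p)" and "\<And>x. x \<in> set_pmf p \<Longrightarrow> f x \<le> g x"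
  shows "(\<integral>x. f x \<partial>p) \<le> (\<integral>x. g x \<partial>p)"
  using assms by (intro integral_mono_AE AE_pmfI integrable_measure_pmf_finite)

lemma prob_cong_pmf:
  assumes "\<And>x. x \<in> set_pmf p \<Longrightarrow> P x \<longleftrightarrow> R x"
  shows "measure p {x. P x} = measure p {x. R x}"
  using assms by (intro measure_pmf.finite_measure_eq_AE AE_pmfI) auto

lemma prob_mono_pmf:
  assumes "\<And>x. x \<in> set_pmf p \<Longrightarrow> P x \<Longrightarrow> R x"
  shows "measure p {x. P x} \<le> measure p {x. R x}"
  using assms by (intro measure_pmf.finite_measure_mono_AE AE_pmfI) auto

lemma exists_le_expectation_pmf:
  fixes g :: "'a \<Rightarrow> real"
  assumes "finite (set_pmf p)"
  shows "\<exists>x\<in>set_pmf p. g x \<le> (\<integral>x. g x \<partial>p)"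
proof (rule ccontr)
  assume "\<not> ?thesis"
  then have "(\<integral>x. g x \<partial>p) < (\<integral>x. g x \<partial>p)"
    using assms
    by (intro measure_pmf.expectation_greater AE_pmfI integrable_measure_pmf_finite)
      (auto simp: not_le)
  then show False by simp
qed

section \<open>Universal hashing\<close>

definition universal_hash :: "('a \<Rightarrow> 'b) pmf \<Rightarrow> 'a set \<Rightarrow> real \<Rightarrow> bool" where
  "universal_hash H A \<kappa> \<longleftrightarrow> (\<forall>a\<in>A. \<forall>b\<in>A. a \<noteq> b \<longrightarrow> measure H {h. h a = h b} \<le> \<kappa>)"

lemma universal_hashD:
  "universal_hash H A \<kappa> \<Longrightarrow> a \<in> A \<Longrightarrow> b \<in> A \<Longrightarrow> a \<noteq> b \<Longrightarrow> measure H {h. h a = h b} \<le> \<kappa>"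
  by (simp add: universal_hash_def)

text \<open>The default value lies in \<open>B\<close>, so that a hash maps everything into \<open>B\<close>.\<close>

definition random_hash :: "'a set \<Rightarrow> 'b set \<Rightarrow> ('a \<Rightarrow> 'b) pmf" where
  "random_hash A B = Pi_pmf A (SOME b. b \<in> B) (\<lambda>_. pmf_of_set B)"

lemma range_random_hash:
  assumes "finite A" "finite B" "B \<noteq> {}" and "h \<in> set_pmf (random_hash A B)"
  shows "h a \<in> B"
  using assms some_in_eq[of B]
  by (cases "a \<in> A") (auto simp: random_hash_def set_Pi_pmf PiE_dflt_def)

lemma finite_set_random_hash:
  assumes "finite A" "finite B" "B \<noteq> {}"
  shows "finite (set_pmf (random_hash A B))"
  using assms by (auto simp: random_hash_def set_Pi_pmf intro!: finite_PiE_dflt)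

lemma universal_random_hash:
  assumes A: "finite A" and B: "finite B" "B \<noteq> {}"
  shows "universal_hash (random_hash A B) A (1 / real (card B))"
  unfolding universal_hash_def
proof (intro ballI impI)
  fix a b assume ab: "a \<in> A" "b \<in> A" "a \<noteq> b"
  let ?F = "random_hash (A - {a}) B"
  have "random_hash (insert a (A - {a})) B = map_pmf (\<lambda>(y, f). f(a := y)) (pair_pmf (pmf_of_set B) ?F)"
    unfolding random_hash_def using A by (intro Pi_pmf_insert) auto
  also have "insert a (A - {a}) = A"
    using ab by auto
  finally have "measure (random_hash A B) {h. h a = h b}
      = measure (pair_pmf (pmf_of_set B) ?F) {(y, f). y = f b}"
    using ab by (simp add: vimage_def case_prod_unfold)
  also have "\<dots> = (\<integral>f. measure (pmf_of_set B) {y. y = f b} \<partial>?F)"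
    using A B by (subst prob_pair_pmf, simp_all add: finite_set_random_hash)
      (simp add: expectation_prob_swap_pmf finite_set_random_hash)
  also have "\<dots> \<le> (\<integral>f. 1 / real (card B) \<partial>?F)"
    using A B by (intro expectation_mono_pmf)
      (auto simp: finite_set_random_hash measure_pmf_single divide_right_mono)
  finally show "measure (random_hash A B) {h. h a = h b} \<le> 1 / real (card B)" by simp
qed

definition pair_hash :: "('a \<Rightarrow> 'b) \<Rightarrow> ('a \<Rightarrow> 'c) \<Rightarrow> 'a \<Rightarrow> 'b \<times> 'c" where
  "pair_hash h k a = (h a, k a)"

lemma universal_pair_hash:
  assumes "universal_hash H A \<kappa>" and "universal_hash K A \<mu>" and "0 \<le> \<kappa>"
    and "finite (set_pmf H)" and "finite (set_pmf K)"
  shows "universal_hash (map_pmf (\<lambda>(h, k). pair_hash h k) (pair_pmf H K)) A (\<kappa> * \<mu>)"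
  unfolding universal_hash_def
proof (intro ballI impI)
  fix a b assume ab: "a \<in> A" "b \<in> A" "a \<noteq> b"
  have "measure (map_pmf (\<lambda>(h, k). pair_hash h k) (pair_pmf H K)) {h. h a = h b}
      = measure (pair_pmf H K) {(h, k). h a = h b \<and> k a = k b}"
    by (auto simp: pair_hash_def intro!: arg_cong[where f = "measure _"])
  also have "\<dots> = measure H {h. h a = h b} * measure K {k. k a = k b}"
    using assms(4,5) by (subst prob_pair_pmf) (simp_all add: of_bool_conj flip: expectation_of_bool_pmf)
  also have "\<dots> \<le> \<kappa> * \<mu>"
    using assms ab by (intro mult_mono universal_hashD) auto
  finally show "measure (map_pmf (\<lambda>(h, k). pair_hash h k) (pair_pmf H K)) {h. h a = h b} \<le> \<kappa> * \<mu>" .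
qed

section \<open>The leftover hash lemma\<close>

definition bin_weight :: "('a \<Rightarrow> real) \<Rightarrow> 'a set \<Rightarrow> ('a \<Rightarrow> 'b) \<Rightarrow> 'b \<Rightarrow> real" where
  "bin_weight q A h b = (\<Sum>a\<in>{a \<in> A. h a = b}. q a)"

lemma sum_bin_weight:
  assumes "finite A" and "finite B" and "h ` A \<subseteq> B"
  shows "(\<Sum>b\<in>B. bin_weight q A h b) = (\<Sum>a\<in>A. q a)"
  unfolding bin_weight_def using assms by (rule sum.group)

lemma sum_bin_weight_squared:
  assumes "finite A" and "finite B" and "h ` A \<subseteq> B"
  shows "(\<Sum>b\<in>B. (bin_weight q A h b)\<^sup>2) = (\<Sum>a\<in>A. \<Sum>a'\<in>A. q a * q a' * of_bool (h a = h a'))"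
proof -
  have "(\<Sum>b\<in>B. (bin_weight q A h b)\<^sup>2) = (\<Sum>b\<in>B. bin_weight (\<lambda>a. q a * bin_weight q A h (h a)) A h b)"
    by (intro sum.cong refl) (simp add: bin_weight_def power2_eq_square sum_distrib_right)
  also have "\<dots> = (\<Sum>a\<in>A. q a * bin_weight q A h (h a))"
    using assms by (rule sum_bin_weight)
  also have "\<dots> = (\<Sum>a\<in>A. \<Sum>a'\<in>A. q a * q a' * of_bool (h a = h a'))"
    using assms(1) by (intro sum.cong refl)
      (simp add: bin_weight_def sum.inter_filter sum_distrib_left of_bool_def eq_commute if_distrib
        cong: if_cong)
  finally show ?thesis .
qed

lemma expectation_sum_bin_weight_squared:
  assumes H: "finite (set_pmf H)" "universal_hash H A \<kappa>" "\<And>h. h \<in> set_pmf H \<Longrightarrow> h ` A \<subseteq> B"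
    and A: "finite A" and B: "finite B" and q: "\<And>a. a \<in> A \<Longrightarrow> 0 \<le> q a"
  shows "(\<integral>h. (\<Sum>b\<in>B. (bin_weight q A h b)\<^sup>2) \<partial>H) \<le> (1 - \<kappa>) * (\<Sum>a\<in>A. (q a)\<^sup>2) + \<kappa> * (\<Sum>a\<in>A. q a)\<^sup>2"
proof -
  have "(\<integral>h. (\<Sum>b\<in>B. (bin_weight q A h b)\<^sup>2) \<partial>H)
      = (\<integral>h. (\<Sum>a\<in>A. \<Sum>a'\<in>A. q a * q a' * of_bool (h a = h a')) \<partial>H)"
    using A B H(3) by (intro integral_cong_AE AE_pmfI) (simp_all add: sum_bin_weight_squared)
  also have "\<dots> = (\<Sum>a\<in>A. \<Sum>a'\<in>A. q a * q a' * measure H {h. h a = h a'})"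
    using H(1) by (simp add: integrable_measure_pmf_finite expectation_of_bool_pmf)
  also have "\<dots> \<le> (\<Sum>a\<in>A. \<Sum>a'\<in>A. \<kappa> * (q a * q a') + (if a = a' then (1 - \<kappa>) * (q a)\<^sup>2 else 0))"
  proof (intro sum_mono)
    fix a a' assume a: "a \<in> A" "a' \<in> A"
    have "q a * q a' * measure H {h. h a = h a'} \<le> q a * q a' * \<kappa>" if "a \<noteq> a'"
      using a that q by (intro mult_left_mono universal_hashD[OF H(2)] mult_nonneg_nonneg)
    then show "q a * q a' * measure H {h. h a = h a'}
        \<le> \<kappa> * (q a * q a') + (if a = a' then (1 - \<kappa>) * (q a)\<^sup>2 else 0)"
      by (auto simp: power2_eq_square algebra_simps)
  qed
  also have "\<dots> = (1 - \<kappa>) * (\<Sum>a\<in>A. (q a)\<^sup>2) + \<kappa> * (\<Sum>a\<in>A. q a)\<^sup>2"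
    using A by (simp add: sum.distrib power2_eq_square sum_product flip: sum_distrib_left)
  finally show ?thesis .
qed

lemma expectation_bin_variance:
  assumes H: "finite (set_pmf H)" "universal_hash H A (1 / real (card B))"
      "\<And>h. h \<in> set_pmf H \<Longrightarrow> h ` A \<subseteq> B"
    and A: "finite A" and B: "finite B" "B \<noteq> {}" and q: "\<And>a. a \<in> A \<Longrightarrow> 0 \<le> q a"
  shows "(\<integral>h. (\<Sum>b\<in>B. (bin_weight q A h b - (\<Sum>a\<in>A. q a) / real (card B))\<^sup>2) \<partial>H)
    \<le> (1 - 1 / real (card B)) * (\<Sum>a\<in>A. (q a)\<^sup>2)"
proof -
  let ?s = "\<Sum>a\<in>A. q a"
  have "(\<Sum>b\<in>B. (bin_weight q A h b - ?s / real (card B))\<^sup>2)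
      = (\<Sum>b\<in>B. (bin_weight q A h b)\<^sup>2) - ?s\<^sup>2 / real (card B)"
    if "h \<in> set_pmf H" for h
  proof -
    have "(\<Sum>b\<in>B. (bin_weight q A h b - c)\<^sup>2)
        = (\<Sum>b\<in>B. (bin_weight q A h b)\<^sup>2) - 2 * c * (\<Sum>b\<in>B. bin_weight q A h b)
          + real (card B) * c\<^sup>2" for c
      by (simp add: power2_diff sum.distrib sum_subtractf sum_distrib_left mult_ac)
    then have "(\<Sum>b\<in>B. (bin_weight q A h b - ?s / real (card B))\<^sup>2)
        = (\<Sum>b\<in>B. (bin_weight q A h b)\<^sup>2) - 2 * (?s / real (card B)) * (\<Sum>b\<in>B. bin_weight q A h b)
          + real (card B) * (?s / real (card B))\<^sup>2" .
    also have "\<dots> = (\<Sum>b\<in>B. (bin_weight q A h b)\<^sup>2) - ?s\<^sup>2 / real (card B)"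
      using B by (simp add: sum_bin_weight[OF A B(1) H(3)[OF that]] power2_eq_square field_simps)
    finally show ?thesis .
  qed
  then have "(\<integral>h. (\<Sum>b\<in>B. (bin_weight q A h b - ?s / real (card B))\<^sup>2) \<partial>H)
      = (\<integral>h. (\<Sum>b\<in>B. (bin_weight q A h b)\<^sup>2) - ?s\<^sup>2 / real (card B) \<partial>H)"
    by (intro integral_cong_AE AE_pmfI) simp_all
  also have "\<dots> = (\<integral>h. (\<Sum>b\<in>B. (bin_weight q A h b)\<^sup>2) \<partial>H) - ?s\<^sup>2 / real (card B)"
    using H(1) by (subst Bochner_Integration.integral_diff) (auto intro: integrable_measure_pmf_finite)
  also have "\<dots> \<le> (1 - 1 / real (card B)) * (\<Sum>a\<in>A. (q a)\<^sup>2)"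
    using expectation_sum_bin_weight_squared[where q = q, OF H A B(1) q] by simp
  finally show ?thesis .
qed

lemma expectation_le_sqrt_expectation_squared_pmf:
  fixes f :: "'a \<Rightarrow> real"
  assumes "finite (set_pmf p)"
  shows "(\<integral>x. f x \<partial>p) \<le> sqrt (\<integral>x. (f x)\<^sup>2 \<partial>p)"
  using measure_pmf.variance_positive[of p f] assms
  by (intro real_le_rsqrt) (simp add: measure_pmf.variance_eq integrable_measure_pmf_finite)

lemma expectation_bin_deviation:
  assumes H: "finite (set_pmf H)" "universal_hash H A (1 / real (card B))"
      "\<And>h. h \<in> set_pmf H \<Longrightarrow> h ` A \<subseteq> B"
    and A: "finite A" and B: "finite B" "B \<noteq> {}" and q: "\<And>a. a \<in> A \<Longrightarrow> 0 \<le> q a"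
  shows "(\<integral>h. (\<Sum>b\<in>B. \<bar>bin_weight q A h b - (\<Sum>a\<in>A. q a) / real (card B)\<bar>) \<partial>H)
    \<le> sqrt ((real (card B) - 1) * (\<Sum>a\<in>A. (q a)\<^sup>2))"
proof -
  let ?d = "\<lambda>h b. bin_weight q A h b - (\<Sum>a\<in>A. q a) / real (card B)"
  have "(\<integral>h. (\<Sum>b\<in>B. \<bar>?d h b\<bar>)\<^sup>2 \<partial>H) \<le> (\<integral>h. real (card B) * (\<Sum>b\<in>B. (?d h b)\<^sup>2) \<partial>H)"
    using H(1) B(1) sum_squared_le_sum_of_squares[of "\<lambda>b. \<bar>?d h b\<bar>" B for h]
    by (intro expectation_mono_pmf) (simp_all add: mult.commute)
  also have "\<dots> \<le> real (card B) * ((1 - 1 / real (card B)) * (\<Sum>a\<in>A. (q a)\<^sup>2))"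
    using expectation_bin_variance[where q = q, OF H A B q] by (simp add: mult_left_mono)
  also have "\<dots> = (real (card B) - 1) * (\<Sum>a\<in>A. (q a)\<^sup>2)"
    using B by (simp add: field_simps)
  finally show ?thesis
    by (intro order_trans[OF expectation_le_sqrt_expectation_squared_pmf[OF H(1)]]) simp
qed

definition uniform_deviation :: "'b set \<Rightarrow> 'b pmf \<Rightarrow> real" where
  "uniform_deviation B r = (\<Sum>b\<in>B. \<bar>pmf r b - 1 / real (card B)\<bar>)"

lemma pmf_map_eq_bin_weight:
  assumes "finite (set_pmf r)"
  shows "pmf (map_pmf h r) b = bin_weight (pmf r) (set_pmf r) h b"
proof -
  have "measure r {a. h a = b} = measure r {a \<in> set_pmf r. h a = b}"
    by (rule prob_cong_pmf) simp
  then show ?thesis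
    using assms by (simp add: pmf_map vimage_def bin_weight_def measure_measure_pmf_finite)
qed

text \<open>Atoms heavier than \<open>\<tau>\<close> are removed before second moments are taken.\<close>

definition light_part :: "real \<Rightarrow> 'a pmf \<Rightarrow> 'a \<Rightarrow> real" where
  "light_part \<tau> r a = (if \<tau> < pmf r a then 0 else pmf r a)"

lemma light_part_nonneg: "0 \<le> light_part \<tau> r a"
  and light_part_le_pmf: "light_part \<tau> r a \<le> pmf r a"
  by (auto simp: light_part_def)

lemma sum_pmf_minus_light_part:
  assumes "finite (set_pmf r)"
  shows "(\<Sum>a\<in>set_pmf r. pmf r a - light_part \<tau> r a) = measure r {a. \<tau> < pmf r a}"
proof -
  have "measure r {a. \<tau> < pmf r a} = measure r {a \<in> set_pmf r. \<tau> < pmf r a}"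
    by (rule prob_cong_pmf) simp
  also have "\<dots> = (\<Sum>a\<in>set_pmf r. pmf r a - light_part \<tau> r a)"
    using assms by (auto simp: measure_measure_pmf_finite sum.inter_filter light_part_def intro!: sum.cong)
  finally show ?thesis ..
qed

lemma sum_light_part_squared_le:
  assumes "finite (set_pmf r)" and "0 \<le> \<tau>"
  shows "(\<Sum>a\<in>set_pmf r. (light_part \<tau> r a)\<^sup>2) \<le> \<tau>"
proof -
  have "(\<Sum>a\<in>set_pmf r. (light_part \<tau> r a)\<^sup>2) \<le> (\<Sum>a\<in>set_pmf r. \<tau> * pmf r a)"
    unfolding power2_eq_square using assms(2)
    by (intro sum_mono mult_mono light_part_le_pmf light_part_nonneg) (auto simp: light_part_def)
  also have "\<dots> = \<tau>"
    using sum_pmf_eq_1[OF assms(1) order_refl] by (simp flip: sum_distrib_left)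
  finally show ?thesis .
qed

lemma uniform_deviation_map_pmf_le:
  fixes r :: "'a pmf" and h :: "'a \<Rightarrow> 'b" and \<tau> :: real
  assumes A: "finite (set_pmf r)" and B: "finite B" "B \<noteq> {}" and h: "h ` set_pmf r \<subseteq> B"
  defines "q \<equiv> light_part \<tau> r"
  shows "uniform_deviation B (map_pmf h r)
    \<le> (\<Sum>b\<in>B. \<bar>bin_weight q (set_pmf r) h b - (\<Sum>a\<in>set_pmf r. q a) / real (card B)\<bar>)
      + 2 * measure r {a. \<tau> < pmf r a}"
proof -
  let ?A = "set_pmf r" and ?heavy = "measure r {a. \<tau> < pmf r a}"
  let ?removed = "bin_weight (\<lambda>a. pmf r a - q a) ?A h"
  let ?deviation = "\<lambda>b. bin_weight q ?A h b - (\<Sum>a\<in>?A. q a) / real (card B)"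
  have removed: "(\<Sum>b\<in>B. ?removed b) = ?heavy"
    using sum_pmf_minus_light_part[OF A] by (simp add: sum_bin_weight[OF A B(1) h] q_def)
  have light: "(\<Sum>a\<in>?A. q a) = 1 - ?heavy"
    using sum_pmf_minus_light_part[OF A, of \<tau>] sum_pmf_eq_1[OF A order_refl]
    by (simp add: sum_subtractf q_def)
  have "\<bar>pmf (map_pmf h r) b - 1 / real (card B)\<bar>
      \<le> \<bar>?deviation b\<bar> + ?removed b + ?heavy / real (card B)" for b
  proof -
    have "pmf (map_pmf h r) b = bin_weight q ?A h b + ?removed b"
      using A by (simp add: pmf_map_eq_bin_weight) (simp add: bin_weight_def sum_subtractf)
    moreover have "0 \<le> ?removed b"
      unfolding bin_weight_def by (intro sum_nonneg) (simp add: q_def light_part_le_pmf)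
    moreover have "(\<Sum>a\<in>?A. q a) / real (card B) = 1 / real (card B) - ?heavy / real (card B)"
      by (simp add: light diff_divide_distrib)
    moreover have "0 \<le> ?heavy / real (card B)" by simp
    ultimately show ?thesis by linarith
  qed
  then have "uniform_deviation B (map_pmf h r)
      \<le> (\<Sum>b\<in>B. \<bar>?deviation b\<bar> + ?removed b + ?heavy / real (card B))"
    unfolding uniform_deviation_def by (rule sum_mono)
  also have "\<dots> = (\<Sum>b\<in>B. \<bar>?deviation b\<bar>) + 2 * ?heavy"
    using B removed by (simp add: sum.distrib)
  finally show ?thesis .
qed

theorem leftover_hash:
  assumes H: "finite (set_pmf H)" "universal_hash H (set_pmf r) (1 / real (card B))"
      "\<And>h. h \<in> set_pmf H \<Longrightarrow> h ` set_pmf r \<subseteq> B"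
    and r: "finite (set_pmf r)" and B: "finite B" "B \<noteq> {}" and \<tau>: "0 \<le> \<tau>"
  shows "(\<integral>h. uniform_deviation B (map_pmf h r) \<partial>H)
    \<le> 2 * measure r {a. \<tau> < pmf r a} + sqrt ((real (card B) - 1) * \<tau>)"
proof -
  let ?A = "set_pmf r" and ?heavy = "measure r {a. \<tau> < pmf r a}" and ?q = "light_part \<tau> r"
  let ?deviation = "\<lambda>h. \<Sum>b\<in>B. \<bar>bin_weight ?q ?A h b - (\<Sum>a\<in>?A. ?q a) / real (card B)\<bar>"
  have "(\<integral>h. uniform_deviation B (map_pmf h r) \<partial>H) \<le> (\<integral>h. ?deviation h + 2 * ?heavy \<partial>H)"
    using H B r by (intro expectation_mono_pmf uniform_deviation_map_pmf_le) auto
  also have "\<dots> = (\<integral>h. ?deviation h \<partial>H) + 2 * ?heavy"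
    using H(1) by (simp add: integrable_measure_pmf_finite)
  also have "(\<integral>h. ?deviation h \<partial>H) \<le> sqrt ((real (card B) - 1) * (\<Sum>a\<in>?A. (?q a)\<^sup>2))"
    by (rule expectation_bin_deviation[OF H r B light_part_nonneg])
  also have "\<dots> \<le> sqrt ((real (card B) - 1) * \<tau>)"
    using sum_light_part_squared_le[OF r \<tau>] B card_gt_0_iff[of B]
    by (intro real_sqrt_le_mono mult_left_mono) auto
  finally show ?thesis by simp
qed

section \<open>Random binning\<close>

definition bin_decoder :: "('a \<Rightarrow> 'b) \<Rightarrow> ('a \<times> 's) set \<Rightarrow> 'b \<Rightarrow> 's \<Rightarrow> 'a" where
  "bin_decoder h T b s = (SOME a. h a = b \<and> (a, s) \<in> T)"

lemma bin_decoder_eq: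
  assumes "(a, s) \<in> T" and "\<And>a'. (a', s) \<in> T \<Longrightarrow> h a' = h a \<Longrightarrow> a' = a"
  shows "bin_decoder h T (h a) s = a"
  unfolding bin_decoder_def using assms by (intro some_equality) auto

lemma prob_bin_decoder_neq:
  assumes H: "universal_hash H A \<kappa>" and A: "finite A" "a \<in> A" and \<kappa>: "0 \<le> \<kappa>"
    and T: "{a'. (a', s) \<in> T} \<subseteq> A"
  shows "measure H {h. bin_decoder h T (h a) s \<noteq> a}
    \<le> of_bool ((a, s) \<notin> T) + \<kappa> * real (card {a'. (a', s) \<in> T})"
proof (cases "(a, s) \<in> T")
  case True
  let ?C = "{a'. (a', s) \<in> T} - {a}"
  have fin: "finite {a'. (a', s) \<in> T}"
    using T A(1) by (rule finite_subset)
  have "{h. bin_decoder h T (h a) s \<noteq> a} \<subseteq> (\<Union>a'\<in>?C. {h. h a' = h a})"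
    using bin_decoder_eq[OF True] by blast
  then have "measure H {h. bin_decoder h T (h a) s \<noteq> a} \<le> measure H (\<Union>a'\<in>?C. {h. h a' = h a})"
    by (intro measure_pmf.finite_measure_mono) auto
  also have "\<dots> \<le> (\<Sum>a'\<in>?C. measure H {h. h a' = h a})"
    using fin by (intro measure_pmf.finite_measure_subadditive_finite) auto
  also have "\<dots> \<le> (\<Sum>a'\<in>?C. \<kappa>)"
    using T A by (intro sum_mono universal_hashD[OF H]) auto
  also have "\<dots> \<le> \<kappa> * real (card {a'. (a', s) \<in> T})"
    using fin \<kappa> card_mono[OF fin, of ?C] by (simp add: mult.commute mult_left_mono)
  finally show ?thesis using True by simp
next
  case False
  have "measure H {h. bin_decoder h T (h a) s \<noteq> a} \<le> 1"
    by simp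
  also have "\<dots> \<le> 1 + \<kappa> * real (card {a'. (a', s) \<in> T})"
    using \<kappa> by simp
  finally show ?thesis using False by simp
qed

definition likely_set :: "'o pmf \<Rightarrow> ('o \<Rightarrow> 'a) \<Rightarrow> ('o \<Rightarrow> 's) \<Rightarrow> real \<Rightarrow> ('a \<times> 's) set" where
  "likely_set P X S \<delta> = {(a, s). \<delta> * pmf (map_pmf S P) s \<le> pmf (map_pmf (\<lambda>\<omega>. (X \<omega>, S \<omega>)) P) (a, s)}"

definition unlikely_prob :: "'o pmf \<Rightarrow> ('o \<Rightarrow> 'a) \<Rightarrow> ('o \<Rightarrow> 's) \<Rightarrow> real \<Rightarrow> real" where
  "unlikely_prob P X S \<delta> = measure P {\<omega>. (X \<omega>, S \<omega>) \<notin> likely_set P X S \<delta>}"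

definition binning_error :: "'o pmf \<Rightarrow> ('o \<Rightarrow> 'a) \<Rightarrow> ('o \<Rightarrow> 's) \<Rightarrow> real \<Rightarrow> ('a \<Rightarrow> 'b) \<Rightarrow> real" where
  "binning_error P X S \<delta> h = measure P {\<omega>. bin_decoder h (likely_set P X S \<delta>) (h (X \<omega>)) (S \<omega>) \<noteq> X \<omega>}"

lemma unlikely_prob_eq:
  "unlikely_prob P X S \<delta>
    = measure P {\<omega>. pmf (map_pmf (\<lambda>\<omega>. (X \<omega>, S \<omega>)) P) (X \<omega>, S \<omega>) < \<delta> * pmf (map_pmf S P) (S \<omega>)}"
  by (simp add: unlikely_prob_def likely_set_def not_le)

lemma likely_set_slice_subset:
  assumes "\<omega> \<in> set_pmf P" and "0 < \<delta>"
  shows "{a. (a, S \<omega>) \<in> likely_set P X S \<delta>} \<subseteq> X ` set_pmf P"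
proof clarify
  fix a assume "(a, S \<omega>) \<in> likely_set P X S \<delta>"
  moreover have "0 < \<delta> * pmf (map_pmf S P) (S \<omega>)"
    using assms by (simp add: pmf_positive)
  ultimately have "0 < pmf (map_pmf (\<lambda>\<omega>. (X \<omega>, S \<omega>)) P) (a, S \<omega>)"
    by (simp add: likely_set_def)
  then show "a \<in> X ` set_pmf P"
    by (auto simp: pmf_positive_iff)
qed

lemma card_likely_set_slice:
  assumes P: "finite (set_pmf P)" and \<omega>: "\<omega> \<in> set_pmf P" and \<delta>: "0 < \<delta>"
  shows "real (card {a. (a, S \<omega>) \<in> likely_set P X S \<delta>}) \<le> 1 / \<delta>"
proof -
  let ?L = "{a. (a, S \<omega>) \<in> likely_set P X S \<delta>}" and ?s = "pmf (map_pmf S P) (S \<omega>)"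
  let ?XS = "map_pmf (\<lambda>\<omega>. (X \<omega>, S \<omega>)) P"
  have fin: "finite ?L"
    by (rule finite_subset[OF likely_set_slice_subset[OF \<omega> \<delta>]]) (use P in simp)
  have "real (card ?L) * (\<delta> * ?s) = (\<Sum>a\<in>?L. \<delta> * ?s)"
    by simp
  also have "\<dots> \<le> (\<Sum>a\<in>?L. pmf ?XS (a, S \<omega>))"
    by (intro sum_mono) (simp add: likely_set_def)
  also have "\<dots> = measure ?XS ((\<lambda>a. (a, S \<omega>)) ` ?L)"
    using fin by (simp add: measure_measure_pmf_finite sum.reindex inj_on_def del: measure_map_pmf)
  also have "\<dots> \<le> measure P (S -` {S \<omega>})"
    by (simp, intro measure_pmf.finite_measure_mono) auto
  also have "\<dots> = ?s"
    by (simp add: pmf_map)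
  finally have "?s * (real (card ?L) * \<delta>) \<le> ?s * 1"
    by (simp add: mult_ac)
  moreover have "0 < ?s"
    using \<omega> by (simp add: pmf_positive)
  ultimately have "real (card ?L) * \<delta> \<le> 1"
    by (simp only: mult_le_cancel_left_pos)
  then show ?thesis using \<delta> by (simp add: pos_le_divide_eq)
qed

lemma expectation_binning_error:
  assumes H: "universal_hash H (X ` set_pmf P) \<kappa>" "finite (set_pmf H)" and P: "finite (set_pmf P)"
    and \<kappa>: "0 \<le> \<kappa>" and \<delta>: "0 < \<delta>"
  shows "(\<integral>h. binning_error P X S \<delta> h \<partial>H) \<le> unlikely_prob P X S \<delta> + \<kappa> / \<delta>"
proof -
  let ?T = "likely_set P X S \<delta>"
  have "(\<integral>h. binning_error P X S \<delta> h \<partial>H)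
      = (\<integral>\<omega>. measure H {h. bin_decoder h ?T (h (X \<omega>)) (S \<omega>) \<noteq> X \<omega>} \<partial>P)"
    unfolding binning_error_def using H(2) P by (rule expectation_prob_swap_pmf)
  also have "\<dots> \<le> (\<integral>\<omega>. of_bool ((X \<omega>, S \<omega>) \<notin> ?T) + \<kappa> * (1 / \<delta>) \<partial>P)"
  proof (rule expectation_mono_pmf[OF P])
    fix \<omega> assume \<omega>: "\<omega> \<in> set_pmf P"
    have "measure H {h. bin_decoder h ?T (h (X \<omega>)) (S \<omega>) \<noteq> X \<omega>}
        \<le> of_bool ((X \<omega>, S \<omega>) \<notin> ?T) + \<kappa> * real (card {a. (a, S \<omega>) \<in> ?T})"
      using P \<omega> by (intro prob_bin_decoder_neq[OF H(1)] likely_set_slice_subset \<kappa> \<delta>) auto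
    also have "\<dots> \<le> of_bool ((X \<omega>, S \<omega>) \<notin> ?T) + \<kappa> * (1 / \<delta>)"
      by (intro add_left_mono mult_left_mono card_likely_set_slice P \<omega> \<delta> \<kappa>)
    finally show "measure H {h. bin_decoder h ?T (h (X \<omega>)) (S \<omega>) \<noteq> X \<omega>}
        \<le> of_bool ((X \<omega>, S \<omega>) \<notin> ?T) + \<kappa> * (1 / \<delta>)" .
  qed
  also have "\<dots> = unlikely_prob P X S \<delta> + \<kappa> / \<delta>"
    using P by (subst Bochner_Integration.integral_add)
      (auto intro: integrable_measure_pmf_finite simp: expectation_of_bool_pmf unlikely_prob_def)
  finally show ?thesis .
qed

definition binning_bound :: "'o pmf \<Rightarrow> ('o \<Rightarrow> 'a) \<Rightarrow> ('o \<Rightarrow> 's) \<Rightarrow> real \<Rightarrow> real \<Rightarrow> real" where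
  "binning_bound P X S \<delta> M = unlikely_prob P X S \<delta> + 1 / (M * \<delta>)"

lemma exists_binning:
  assumes "finite (set_pmf P)" and "finite B" "B \<noteq> {}" and "0 < \<delta>"
  obtains h where "range h \<subseteq> B" and "binning_error P X S \<delta> h \<le> binning_bound P X S \<delta> (real (card B))"
proof -
  let ?H = "random_hash (X ` set_pmf P) B"
  have H: "finite (set_pmf ?H)" "universal_hash ?H (X ` set_pmf P) (1 / real (card B))"
    using assms by (auto simp: finite_set_random_hash universal_random_hash)
  obtain h where "h \<in> set_pmf ?H" "binning_error P X S \<delta> h \<le> (\<integral>h. binning_error P X S \<delta> h \<partial>?H)"
    using exists_le_expectation_pmf[OF H(1)] by blast
  moreover have "(\<integral>h. binning_error P X S \<delta> h \<partial>?H) \<le> binning_bound P X S \<delta> (real (card B))"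
    using expectation_binning_error[OF H(2,1) assms(1) _ assms(4)] by (simp add: binning_bound_def)
  moreover have "range h \<subseteq> B"
    using assms \<open>h \<in> set_pmf ?H\<close> range_random_hash[of "X ` set_pmf P" B h] by auto
  ultimately show ?thesis by (meson order_trans that)
qed

lemma expectation_pair_binning_error:
  fixes P :: "'o pmf" and X :: "'o \<Rightarrow> 'a" and B :: "'b set" and C :: "'c set"
  assumes P: "finite (set_pmf P)" and B: "finite B" "B \<noteq> {}" and C: "finite C" "C \<noteq> {}" and \<delta>: "0 < \<delta>"
  defines "A \<equiv> X ` set_pmf P"
  shows "(\<integral>(F, G). binning_error P X S \<delta> (pair_hash F G) \<partial>pair_pmf (random_hash A B) (random_hash A C))
    \<le> binning_bound P X S \<delta> (real (card B) * real (card C))"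
proof -
  let ?FG = "map_pmf (\<lambda>(F, G). pair_hash F G) (pair_pmf (random_hash A B) (random_hash A C))"
  have A: "finite A"
    by (simp add: A_def P)
  have fin: "finite (set_pmf (random_hash A B))" "finite (set_pmf (random_hash A C))"
    using A B C by (simp_all add: finite_set_random_hash)
  have "universal_hash ?FG A (1 / real (card B) * (1 / real (card C)))"
    by (intro universal_pair_hash universal_random_hash A B C fin) simp
  then have "(\<integral>h. binning_error P X S \<delta> h \<partial>?FG)
      \<le> unlikely_prob P X S \<delta> + 1 / real (card B) * (1 / real (card C)) / \<delta>"
    unfolding A_def by (intro expectation_binning_error P \<delta>) (use fin in \<open>simp_all add: A_def\<close>)
  then show ?thesis
    by (simp add: binning_bound_def case_prod_unfold)
qed

text \<open>The receiver recovers \<open>W\<close> first and then uses it as further side information.\<close>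

definition receiver_decoder ::
    "'o pmf \<Rightarrow> ('o \<Rightarrow> 'w) \<Rightarrow> ('o \<Rightarrow> 'a) \<Rightarrow> ('o \<Rightarrow> 's) \<Rightarrow> real \<Rightarrow> real
      \<Rightarrow> ('w \<Rightarrow> 'b) \<Rightarrow> ('a \<Rightarrow> 'c) \<Rightarrow> 'b \<Rightarrow> 'c \<Rightarrow> 's \<Rightarrow> 'a" where
  "receiver_decoder P W X S \<delta> \<epsilon> k h b c s =
     bin_decoder h (likely_set P X (\<lambda>\<omega>. (W \<omega>, S \<omega>)) \<epsilon>) c (bin_decoder k (likely_set P W S \<delta>) b s, s)"

definition receiver_error ::
    "'o pmf \<Rightarrow> ('o \<Rightarrow> 'w) \<Rightarrow> ('o \<Rightarrow> 'a) \<Rightarrow> ('o \<Rightarrow> 's) \<Rightarrow> real \<Rightarrow> real \<Rightarrow> ('w \<Rightarrow> 'b) \<Rightarrow> ('a \<Rightarrow> 'c) \<Rightarrow> real" where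
  "receiver_error P W X S \<delta> \<epsilon> k h = binning_error P W S \<delta> k + binning_error P X (\<lambda>\<omega>. (W \<omega>, S \<omega>)) \<epsilon> h"

definition receiver_bound ::
    "'o pmf \<Rightarrow> ('o \<Rightarrow> 'w) \<Rightarrow> ('o \<Rightarrow> 'a) \<Rightarrow> ('o \<Rightarrow> 's) \<Rightarrow> real \<Rightarrow> real \<Rightarrow> real \<Rightarrow> real \<Rightarrow> real" where
  "receiver_bound P W X S \<delta> \<epsilon> N M = binning_bound P W S \<delta> N + binning_bound P X (\<lambda>\<omega>. (W \<omega>, S \<omega>)) \<epsilon> M"

lemma prob_receiver_decoder_neq:
  fixes P :: "'o pmf"
  shows "measure P {\<omega>. receiver_decoder P W X S \<delta> \<epsilon> k h (k (W \<omega>)) (h (X \<omega>)) (S \<omega>) \<noteq> X \<omega>}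
    \<le> receiver_error P W X S \<delta> \<epsilon> k h" (is "measure P ?E \<le> _")
proof -
  let ?WS = "\<lambda>\<omega>. (W \<omega>, S \<omega>)"
  have "measure P ?E \<le> measure P ({\<omega>. bin_decoder k (likely_set P W S \<delta>) (k (W \<omega>)) (S \<omega>) \<noteq> W \<omega>}
      \<union> {\<omega>. bin_decoder h (likely_set P X ?WS \<epsilon>) (h (X \<omega>)) (?WS \<omega>) \<noteq> X \<omega>})"
    by (intro measure_pmf.finite_measure_mono) (auto simp: receiver_decoder_def)
  also have "\<dots> \<le> receiver_error P W X S \<delta> \<epsilon> k h"
    unfolding receiver_error_def binning_error_def by (intro measure_Un_le) auto
  finally show ?thesis .
qed

section \<open>Shared randomness\<close>

definition joint_pmf :: "'z pmf \<Rightarrow> ('z \<Rightarrow> 'w pmf) \<Rightarrow> ('w \<times> 'z) pmf" where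
  "joint_pmf Q K = bind_pmf Q (\<lambda>z. map_pmf (\<lambda>w. (w, z)) (K z))"

lemma pmf_joint_pmf: "pmf (joint_pmf Q K) (w, z) = pmf Q z * pmf (K z) w"
proof -
  have "pmf (map_pmf (\<lambda>w. (w, z')) (K z')) (w, z) = indicator {z} z' * pmf (K z) w" for z'
    by (cases "z' = z")
      (auto simp: pmf_map vimage_def measure_pmf_single[symmetric] intro!: arg_cong[where f = "measure _"])
  then show ?thesis
    by (simp add: joint_pmf_def pmf_bind measure_pmf_single)
qed

lemma map_snd_joint_pmf: "map_pmf snd (joint_pmf Q K) = Q"
  by (simp add: joint_pmf_def map_bind_pmf map_pmf_comp bind_return_pmf')

lemma joint_pmf_map_pmf:
  "joint_pmf (map_pmf g Q) K = map_pmf (\<lambda>(w, z). (w, g z)) (joint_pmf Q (\<lambda>z. K (g z)))"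
  by (simp add: joint_pmf_def map_bind_pmf bind_map_pmf map_pmf_comp)

lemma set_joint_pmf: "set_pmf (joint_pmf Q K) = {(w, z). z \<in> set_pmf Q \<and> w \<in> set_pmf (K z)}"
  by (auto simp: joint_pmf_def)

lemma finite_set_joint_pmf:
  assumes "finite (set_pmf Q)" and "\<And>z. finite (set_pmf (K z))"
  shows "finite (set_pmf (joint_pmf Q K))"
  using assms by (simp add: joint_pmf_def)

lemma expectation_joint_pmf:
  fixes f :: "'w \<times> 'z \<Rightarrow> real"
  assumes "finite (set_pmf Q)" and "\<And>z. finite (set_pmf (K z))"
  shows "(\<integral>j. f j \<partial>joint_pmf Q K) = (\<integral>z. (\<integral>w. f (w, z) \<partial>K z) \<partial>Q)"
  using assms by (simp add: joint_pmf_def expectation_bind_pmf)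

lemma prob_joint_pmf:
  assumes "finite (set_pmf Q)" and "\<And>z. finite (set_pmf (K z))"
  shows "measure (joint_pmf Q K) {(w, z). R w z} = (\<integral>z. measure (K z) {w. R w z} \<partial>Q)"
  using expectation_joint_pmf[of Q K "\<lambda>(w, z). of_bool (R w z)", OF assms]
  by (simp add: case_prod_unfold expectation_of_bool_pmf)

definition bin_bias :: "'z pmf \<Rightarrow> ('z \<Rightarrow> 'w pmf) \<Rightarrow> 'b set \<Rightarrow> ('w \<Rightarrow> 'b) \<Rightarrow> real" where
  "bin_bias Q K B F = (\<integral>z. uniform_deviation B (map_pmf F (K z)) \<partial>Q)"

definition heavy_prob :: "'z pmf \<Rightarrow> ('z \<Rightarrow> 'w pmf) \<Rightarrow> real \<Rightarrow> real" where
  "heavy_prob Q K \<tau> = measure (joint_pmf Q K) {(w, z). \<tau> < pmf (K z) w}"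

definition bias_bound :: "'z pmf \<Rightarrow> ('z \<Rightarrow> 'w pmf) \<Rightarrow> real \<Rightarrow> real \<Rightarrow> real" where
  "bias_bound Q K \<tau> m = 2 * heavy_prob Q K \<tau> + sqrt ((m - 1) * \<tau>)"

lemma expectation_bin_bias:
  assumes H: "finite (set_pmf H)" "universal_hash H A (1 / real (card B))"
      "\<And>h a. h \<in> set_pmf H \<Longrightarrow> h a \<in> B"
    and Q: "finite (set_pmf Q)"
    and K: "\<And>z. finite (set_pmf (K z))" "\<And>z. z \<in> set_pmf Q \<Longrightarrow> set_pmf (K z) \<subseteq> A"
    and B: "finite B" "B \<noteq> {}" and \<tau>: "0 \<le> \<tau>"
  shows "(\<integral>F. bin_bias Q K B F \<partial>H) \<le> bias_bound Q K \<tau> (real (card B))"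
proof -
  have "(\<integral>F. bin_bias Q K B F \<partial>H) = (\<integral>z. (\<integral>F. uniform_deviation B (map_pmf F (K z)) \<partial>H) \<partial>Q)"
    unfolding bin_bias_def using H(1) Q by (rule expectation_swap_pmf)
  also have "\<dots> \<le> (\<integral>z. 2 * measure (K z) {w. \<tau> < pmf (K z) w} + sqrt ((real (card B) - 1) * \<tau>) \<partial>Q)"
  proof (intro expectation_mono_pmf[OF Q] leftover_hash H(1) K(1) B \<tau>)
    fix z assume "z \<in> set_pmf Q"
    then show "universal_hash H (set_pmf (K z)) (1 / real (card B))"
      using H(2) K(2) by (auto simp: universal_hash_def)
  qed (use H(3) in auto)
  also have "\<dots> = bias_bound Q K \<tau> (real (card B))"
    using Q K(1) by (subst Bochner_Integration.integral_add)
      (auto intro: integrable_measure_pmf_finite simp: bias_bound_def heavy_prob_def prob_joint_pmf)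
  finally show ?thesis .
qed

lemma uniform_average_le_bin_expectation:
  fixes loss :: "'w \<Rightarrow> 'b \<Rightarrow> real"
  assumes c: "finite (set_pmf c)" and B: "finite B" and F: "\<And>w. F w \<in> B"
    and best: "\<And>b w. w \<in> set_pmf c \<Longrightarrow> best b \<le> loss w b" "\<And>b. 0 \<le> best b" "\<And>b. best b \<le> M"
  shows "(\<Sum>b\<in>B. best b) / real (card B) \<le> (\<integral>w. loss w (F w) \<partial>c) + M * uniform_deviation B (map_pmf F c)"
proof -
  let ?r = "map_pmf F c"
  have "best b / real (card B) \<le> pmf ?r b * best b + M * \<bar>pmf ?r b - 1 / real (card B)\<bar>" for b
  proof -
    have "best b * (1 / real (card B)) \<le> best b * (pmf ?r b + \<bar>pmf ?r b - 1 / real (card B)\<bar>)"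
      using best(2) by (intro mult_left_mono) auto
    also have "\<dots> \<le> best b * pmf ?r b + M * \<bar>pmf ?r b - 1 / real (card B)\<bar>"
      using best(3) by (simp add: distrib_left mult_right_mono)
    finally show ?thesis by (simp add: mult.commute)
  qed
  then have "(\<Sum>b\<in>B. best b) / real (card B)
      \<le> (\<Sum>b\<in>B. pmf ?r b * best b + M * \<bar>pmf ?r b - 1 / real (card B)\<bar>)"
    unfolding sum_divide_distrib by (rule sum_mono)
  also have "\<dots> = (\<Sum>b\<in>B. pmf ?r b * best b) + M * uniform_deviation B ?r"
    by (simp add: sum.distrib sum_distrib_left uniform_deviation_def)
  also have "(\<Sum>b\<in>B. pmf ?r b * best b) = (\<integral>b. best b \<partial>?r)"
    using B F by (subst integral_measure_pmf[of B]) auto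
  also have "\<dots> \<le> (\<integral>w. loss w (F w) \<partial>c)"
    using best(1) c by (simp, intro expectation_mono_pmf)
  finally show ?thesis by simp
qed

definition fibre_expectation :: "'z pmf \<Rightarrow> ('z \<Rightarrow> 'e) \<Rightarrow> 'e \<Rightarrow> ('z \<Rightarrow> real) \<Rightarrow> real" where
  "fibre_expectation Q E e f = (\<integral>z. of_bool (E z = e) * f z \<partial>Q)"

lemma fibre_expectation_const: "fibre_expectation Q E e (\<lambda>_. a) = measure Q {z. E z = e} * a"
  by (simp add: fibre_expectation_def expectation_of_bool_pmf)

lemma fibre_expectation_mono:
  assumes "finite (set_pmf Q)" and "\<And>z. f z \<le> g z"
  shows "fibre_expectation Q E e f \<le> fibre_expectation Q E e g"
  unfolding fibre_expectation_def using assms by (intro expectation_mono_pmf mult_left_mono) auto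

lemma sum_fibre_expectation:
  assumes "finite (set_pmf Q)"
  shows "(\<Sum>e\<in>E ` set_pmf Q. fibre_expectation Q E e (f e)) = (\<integral>z. f (E z) z \<partial>Q)"
proof -
  have "(\<Sum>e\<in>E ` set_pmf Q. fibre_expectation Q E e (f e))
      = (\<integral>z. (\<Sum>e\<in>E ` set_pmf Q. of_bool (E z = e) * f e z) \<partial>Q)"
    unfolding fibre_expectation_def using assms
    by (intro Bochner_Integration.integral_sum[symmetric] integrable_measure_pmf_finite)
  also have "\<dots> = (\<integral>z. f (E z) z \<partial>Q)"
    using assms by (intro integral_cong_AE AE_pmfI)
      (simp_all add: of_bool_def if_distrib[of "\<lambda>x. x * _"] cong: if_cong)
  finally show ?thesis .
qed

lemma sum_fibre_expectation_kernel:
  assumes "finite (set_pmf Q)" and "\<And>e. finite (set_pmf (k e))"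
  shows "(\<Sum>e\<in>E ` set_pmf Q. (\<integral>w. fibre_expectation Q E e (f w) \<partial>k e))
    = (\<integral>(w, z). f w z \<partial>joint_pmf Q (\<lambda>z. k (E z)))"
proof -
  have "(\<Sum>e\<in>E ` set_pmf Q. (\<integral>w. fibre_expectation Q E e (f w) \<partial>k e))
      = (\<Sum>e\<in>E ` set_pmf Q. fibre_expectation Q E e (\<lambda>z. (\<integral>w. f w z \<partial>k e)))"
    unfolding fibre_expectation_def by (subst expectation_swap_pmf[OF assms(2,1)]) simp
  also have "\<dots> = (\<integral>z. (\<integral>w. f w z \<partial>k (E z)) \<partial>Q)"
    by (rule sum_fibre_expectation[OF assms(1)])
  also have "\<dots> = (\<integral>(w, z). f w z \<partial>joint_pmf Q (\<lambda>z. k (E z)))"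
    using assms by (simp add: expectation_joint_pmf)
  finally show ?thesis .
qed

text \<open>Here \<open>F\<close> stands for randomness shared by encoder and decoders. Under the ideal law \<open>w\<close>
  is drawn from the kernel and \<open>b = F w\<close>; since \<open>b\<close> is then almost uniform and independent of the
  source, some constant \<open>b\<close> is as good, and the best \<open>w\<close> for this \<open>b\<close> does at least as well
  as a random one.\<close>

lemma fix_shared_randomness:
  fixes E :: "'z \<Rightarrow> 'e" and loss :: "'w \<Rightarrow> 'b \<Rightarrow> 'z \<Rightarrow> real" and k :: "'e \<Rightarrow> 'w pmf"
  assumes Q: "finite (set_pmf Q)" and k: "\<And>e. finite (set_pmf (k e))"
    and B: "finite B" "B \<noteq> {}" and F: "\<And>w. F w \<in> B"
    and loss: "\<And>w b z. 0 \<le> loss w b z" "\<And>w b z. loss w b z \<le> M"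
  defines "K \<equiv> \<lambda>z. k (E z)"
  shows "\<exists>b enc. (\<integral>z. loss (enc (E z)) b z \<partial>Q)
    \<le> (\<integral>(w, z). loss w (F w) z \<partial>joint_pmf Q K) + M * bin_bias Q K B F" (is "\<exists>b enc. _ \<le> ?R")
proof -
  let ?cost = "\<lambda>e w b. fibre_expectation Q E e (loss w b)"
  let ?max_cost = "\<lambda>e. fibre_expectation Q E e (\<lambda>_. M)"
  have cost_bounds: "0 \<le> ?cost e w b" "?cost e w b \<le> ?max_cost e" for e w b
    using fibre_expectation_mono[OF Q, of "\<lambda>_. 0" "loss w b" E e]
      fibre_expectation_mono[OF Q, of "loss w b" "\<lambda>_. M" E e] loss
    by (auto simp: fibre_expectation_const)
  define enc where "enc b e = arg_min_on (\<lambda>w. ?cost e w b) (set_pmf (k e))" for b e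
  have enc_minimal: "?cost e (enc b e) b \<le> ?cost e w b" if "w \<in> set_pmf (k e)" for e b w
    unfolding enc_def using k set_pmf_not_empty that by (rule arg_min_least)
  let ?mean_loss = "\<lambda>b. \<integral>z. loss (enc b (E z)) b z \<partial>Q"
  have "(\<integral>b. ?mean_loss b \<partial>pmf_of_set B)
      = (\<Sum>e\<in>E ` set_pmf Q. (\<Sum>b\<in>B. ?cost e (enc b e) b) / real (card B))"
    using B sum_fibre_expectation[OF Q, where E = E and f = "\<lambda>e. loss (enc b e) b" for b]
    by (simp add: integral_pmf_of_set sum.swap[of _ B] flip: sum_divide_distrib)
  also have "\<dots> \<le> (\<Sum>e\<in>E ` set_pmf Q. (\<integral>w. ?cost e w (F w) \<partial>k e)
      + ?max_cost e * uniform_deviation B (map_pmf F (k e)))"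
    by (intro sum_mono uniform_average_le_bin_expectation k B F enc_minimal cost_bounds)
  also have "\<dots> = (\<Sum>e\<in>E ` set_pmf Q. (\<integral>w. ?cost e w (F w) \<partial>k e))
      + M * (\<Sum>e\<in>E ` set_pmf Q. fibre_expectation Q E e (\<lambda>_. uniform_deviation B (map_pmf F (k e))))"
    by (simp add: sum.distrib fibre_expectation_const sum_distrib_left mult_ac)
  also have "\<dots> = ?R"
    by (simp only: sum_fibre_expectation_kernel[OF Q k, where f = "\<lambda>w. loss w (F w)"]
        sum_fibre_expectation[OF Q] K_def bin_bias_def)
  finally have "(\<integral>b. ?mean_loss b \<partial>pmf_of_set B) \<le> ?R" .
  moreover obtain b where "?mean_loss b \<le> (\<integral>b. ?mean_loss b \<partial>pmf_of_set B)"
    using exists_le_expectation_pmf[of "pmf_of_set B" ?mean_loss] B by auto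
  ultimately show ?thesis by (meson order_trans)
qed

section \<open>A one-shot coding theorem\<close>

lemma exists_double_binning:
  fixes Q :: "'z pmf" and K :: "'z \<Rightarrow> 'w pmf" and S1 :: "'w \<times> 'z \<Rightarrow> 's" and S2 :: "'w \<times> 'z \<Rightarrow> 't"
  assumes Q: "finite (set_pmf Q)" and K: "\<And>z. finite (set_pmf (K z))"
    and B: "finite B" "B \<noteq> {}" and C: "finite C" "C \<noteq> {}" and pos: "0 < \<delta>" "0 \<le> \<tau>" "0 \<le> c"
  defines "J \<equiv> joint_pmf Q K" and "N \<equiv> real (card B) * real (card C)"
  obtains F G where "range F \<subseteq> B" and "range G \<subseteq> C"
    and "binning_error J fst S1 \<delta> (pair_hash F G) + binning_error J fst S2 \<delta> (pair_hash F G)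
        + c * bin_bias Q K B F
      \<le> binning_bound J fst S1 \<delta> N + binning_bound J fst S2 \<delta> N + c * bias_bound Q K \<tau> (real (card B))"
proof -
  have J: "finite (set_pmf J)"
    by (simp add: J_def finite_set_joint_pmf Q K)
  define A where "A = fst ` set_pmf J"
  have A: "finite A" "\<And>z. z \<in> set_pmf Q \<Longrightarrow> set_pmf (K z) \<subseteq> A"
    using J by (force simp: A_def J_def set_joint_pmf)+
  let ?F = "random_hash A B" and ?G = "random_hash A C"
  let ?error = "\<lambda>F G. binning_error J fst S1 \<delta> (pair_hash F G) + binning_error J fst S2 \<delta> (pair_hash F G)
    + c * bin_bias Q K B F"
  have fin: "finite (set_pmf ?F)" "finite (set_pmf (pair_pmf ?F ?G))"
    using A(1) B C by (auto simp: finite_set_random_hash)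
  have error: "(\<integral>(F, G). binning_error J fst S \<delta> (pair_hash F G) \<partial>pair_pmf ?F ?G)
      \<le> binning_bound J fst S \<delta> N"
    for S :: "'w \<times> 'z \<Rightarrow> 'r"
    unfolding A_def N_def by (intro expectation_pair_binning_error J B C pos)
  have bias: "(\<integral>F. bin_bias Q K B F \<partial>?F) \<le> bias_bound Q K \<tau> (real (card B))"
    using range_random_hash[OF A(1) B]
    by (intro expectation_bin_bias[where A = A] fin(1) universal_random_hash A B Q K pos(2))
  obtain F G where FG: "(F, G) \<in> set_pmf (pair_pmf ?F ?G)"
    and below_average: "?error F G \<le> (\<integral>(F, G). ?error F G \<partial>pair_pmf ?F ?G)"
    using exists_le_expectation_pmf[OF fin(2), of "\<lambda>(F, G). ?error F G"] by auto
  note below_average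
  also have "(\<integral>(F, G). ?error F G \<partial>pair_pmf ?F ?G)
      = (\<integral>(F, G). binning_error J fst S1 \<delta> (pair_hash F G) \<partial>pair_pmf ?F ?G)
      + (\<integral>(F, G). binning_error J fst S2 \<delta> (pair_hash F G) \<partial>pair_pmf ?F ?G)
      + c * (\<integral>F. bin_bias Q K B F \<partial>?F)"
    using fin(2) by (simp add: case_prod_unfold integrable_measure_pmf_finite)
  also have "\<dots> \<le> binning_bound J fst S1 \<delta> N + binning_bound J fst S2 \<delta> N
      + c * bias_bound Q K \<tau> (real (card B))"
    by (intro add_mono mult_left_mono error bias pos)
  finally show ?thesis
    using FG range_random_hash[OF A(1) B, of F] range_random_hash[OF A(1) C, of G]
    by (intro that[of F G]) auto
qed

lemma code_of_hashes:
  fixes Q :: "'z pmf" and E :: "'z \<Rightarrow> 'e" and k :: "'e \<Rightarrow> 'w pmf"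
    and X :: "'z \<Rightarrow> 'x" and Y :: "'z \<Rightarrow> 'y" and U :: "'z \<Rightarrow> 'u" and V :: "'z \<Rightarrow> 'v"
  assumes Q: "finite (set_pmf Q)" and k: "\<And>e. finite (set_pmf (k e))"
    and B: "finite B" "B \<noteq> {}" and F: "range F \<subseteq> B"
  defines "K \<equiv> \<lambda>z. k (E z)"
  defines "J \<equiv> joint_pmf Q K"
  obtains enc dx dy where "range enc \<subseteq> range G"
    and "measure Q {z. dx (enc (E z)) (hx (X z)) (U z) \<noteq> X z}
        + measure Q {z. dy (enc (E z)) (hy (Y z)) (V z) \<noteq> Y z}
      \<le> receiver_error J fst (\<lambda>j. X (snd j)) (\<lambda>j. U (snd j)) \<delta> \<delta>x (pair_hash F G) hx
      + receiver_error J fst (\<lambda>j. Y (snd j)) (\<lambda>j. V (snd j)) \<delta> \<delta>y (pair_hash F G) hy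
      + 2 * bin_bias Q K B F"
proof -
  have J: "finite (set_pmf J)"
    by (simp add: J_def K_def finite_set_joint_pmf Q k)
  define dx where "dx b c =
    receiver_decoder J fst (\<lambda>j. X (snd j)) (\<lambda>j. U (snd j)) \<delta> \<delta>x (pair_hash F G) hx (b, c)" for b c
  define dy where "dy b c =
    receiver_decoder J fst (\<lambda>j. Y (snd j)) (\<lambda>j. V (snd j)) \<delta> \<delta>y (pair_hash F G) hy (b, c)" for b c
  define loss :: "'w \<Rightarrow> _ \<Rightarrow> 'z \<Rightarrow> real" where
    "loss w b z = of_bool (dx b (G w) (hx (X z)) (U z) \<noteq> X z)
      + of_bool (dy b (G w) (hy (Y z)) (V z) \<noteq> Y z)" for w b z
  have "\<exists>b enc. (\<integral>z. loss (enc (E z)) b z \<partial>Q) \<le> (\<integral>(w, z). loss w (F w) z \<partial>J) + 2 * bin_bias Q K B F"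
    unfolding J_def K_def using F by (intro fix_shared_randomness[OF Q k B]) (auto simp: loss_def)
  then obtain b enc
    where enc: "(\<integral>z. loss (enc (E z)) b z \<partial>Q) \<le> (\<integral>(w, z). loss w (F w) z \<partial>J) + 2 * bin_bias Q K B F"
    by blast
  have "(\<integral>(w, z). loss w (F w) z \<partial>J) =
      measure J {j. dx (F (fst j)) (G (fst j)) (hx (X (snd j))) (U (snd j)) \<noteq> X (snd j)}
      + measure J {j. dy (F (fst j)) (G (fst j)) (hy (Y (snd j))) (V (snd j)) \<noteq> Y (snd j)}"
    using J by (simp add: loss_def case_prod_unfold integrable_measure_pmf_finite expectation_of_bool_pmf)
  also have "\<dots> \<le> receiver_error J fst (\<lambda>j. X (snd j)) (\<lambda>j. U (snd j)) \<delta> \<delta>x (pair_hash F G) hx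
      + receiver_error J fst (\<lambda>j. Y (snd j)) (\<lambda>j. V (snd j)) \<delta> \<delta>y (pair_hash F G) hy"
    unfolding dx_def dy_def pair_hash_def[symmetric] by (intro add_mono prob_receiver_decoder_neq)
  finally show ?thesis
    using enc Q by (intro that[of "\<lambda>e. G (enc e)" "dx b" "dy b"])
      (auto simp: loss_def integrable_measure_pmf_finite expectation_of_bool_pmf)
qed

theorem one_shot_code:
  fixes Q :: "'z pmf" and E :: "'z \<Rightarrow> 'e" and k :: "'e \<Rightarrow> 'w pmf"
    and X :: "'z \<Rightarrow> 'x" and Y :: "'z \<Rightarrow> 'y" and U :: "'z \<Rightarrow> 'u" and V :: "'z \<Rightarrow> 'v"
  assumes Q: "finite (set_pmf Q)" and k: "\<And>e. finite (set_pmf (k e))"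
    and B: "finite B" "B \<noteq> {}" and C: "finite C0" "C0 \<noteq> {}" "finite C1" "C1 \<noteq> {}" "finite C2" "C2 \<noteq> {}"
    and pos: "0 < \<delta>" "0 < \<delta>x" "0 < \<delta>y" "0 \<le> \<tau>"
  defines "K \<equiv> \<lambda>z. k (E z)"
  defines "J \<equiv> joint_pmf Q K" and "N \<equiv> real (card B) * real (card C0)"
  obtains enc hx hy dx dy where "range enc \<subseteq> C0" and "range hx \<subseteq> C1" and "range hy \<subseteq> C2"
    and "measure Q {z. dx (enc (E z)) (hx (X z)) (U z) \<noteq> X z}
        + measure Q {z. dy (enc (E z)) (hy (Y z)) (V z) \<noteq> Y z}
      \<le> receiver_bound J fst (\<lambda>j. X (snd j)) (\<lambda>j. U (snd j)) \<delta> \<delta>x N (real (card C1))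
      + receiver_bound J fst (\<lambda>j. Y (snd j)) (\<lambda>j. V (snd j)) \<delta> \<delta>y N (real (card C2))
      + 2 * bias_bound Q K \<tau> (real (card B))"
proof -
  have K: "finite (set_pmf (K z))" for z
    by (simp add: K_def k)
  have J: "finite (set_pmf J)"
    by (simp add: J_def finite_set_joint_pmf Q K)
  let ?WU = "\<lambda>j. (fst j, U (snd j))" and ?WV = "\<lambda>j. (fst j, V (snd j))"
  obtain F G where F: "range F \<subseteq> B" and G: "range G \<subseteq> C0"
    and FG: "binning_error J fst (\<lambda>j. U (snd j)) \<delta> (pair_hash F G)
        + binning_error J fst (\<lambda>j. V (snd j)) \<delta> (pair_hash F G)
        + 2 * bin_bias Q K B F
      \<le> binning_bound J fst (\<lambda>j. U (snd j)) \<delta> N + binning_bound J fst (\<lambda>j. V (snd j)) \<delta> N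
        + 2 * bias_bound Q K \<tau> (real (card B))"
    unfolding J_def N_def by (rule exists_double_binning[OF Q K B C(1,2) pos(1,4) zero_le_numeral])
  obtain hx where hx: "range hx \<subseteq> C1"
    "binning_error J (\<lambda>j. X (snd j)) ?WU \<delta>x hx \<le> binning_bound J (\<lambda>j. X (snd j)) ?WU \<delta>x (real (card C1))"
    by (rule exists_binning[OF J C(3,4) pos(2)])
  obtain hy where hy: "range hy \<subseteq> C2"
    "binning_error J (\<lambda>j. Y (snd j)) ?WV \<delta>y hy \<le> binning_bound J (\<lambda>j. Y (snd j)) ?WV \<delta>y (real (card C2))"
    by (rule exists_binning[OF J C(5,6) pos(3)])
  obtain enc dx dy where enc: "range enc \<subseteq> range G"
    and error: "measure Q {z. dx (enc (E z)) (hx (X z)) (U z) \<noteq> X z}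
        + measure Q {z. dy (enc (E z)) (hy (Y z)) (V z) \<noteq> Y z}
      \<le> receiver_error J fst (\<lambda>j. X (snd j)) (\<lambda>j. U (snd j)) \<delta> \<delta>x (pair_hash F G) hx
      + receiver_error J fst (\<lambda>j. Y (snd j)) (\<lambda>j. V (snd j)) \<delta> \<delta>y (pair_hash F G) hy
      + 2 * bin_bias Q K B F"
    unfolding J_def K_def by (rule code_of_hashes[OF Q k B F])
  note error
  also have "\<dots> \<le> receiver_bound J fst (\<lambda>j. X (snd j)) (\<lambda>j. U (snd j)) \<delta> \<delta>x N (real (card C1))
      + receiver_bound J fst (\<lambda>j. Y (snd j)) (\<lambda>j. V (snd j)) \<delta> \<delta>y N (real (card C2))
      + 2 * bias_bound Q K \<tau> (real (card B))"
    unfolding receiver_error_def receiver_bound_def using FG hx(2) hy(2) by linarith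
  finally show ?thesis
    by (rule that[OF order_trans[OF enc G] hx(1) hy(1)])
qed

section \<open>Entropy\<close>

lemma ent_pmf: "ent (pmf p) f = - (\<integral>x. log 2 (pmf (map_pmf f p) (f x)) \<partial>p)" for p :: "'o::finite pmf"
proof -
  have law: "(\<Sum>x\<in>{x. f x = z}. pmf p x) = pmf (map_pmf f p) z" for z
    by (simp add: pmf_map vimage_def measure_measure_pmf_finite)
  have "(\<integral>x. log 2 (pmf (map_pmf f p) (f x)) \<partial>p) = (\<integral>z. log 2 (pmf (map_pmf f p) z) \<partial>map_pmf f p)"
    by simp
  also have "\<dots> = (\<Sum>z\<in>range f. pmf (map_pmf f p) z * log 2 (pmf (map_pmf f p) z))"
    by (subst integral_measure_pmf[of "range f"]) auto
  finally show ?thesis by (simp add: ent_def law)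
qed

lemma cent_pmf:
  "cent (pmf p) f g
    = (\<integral>x. log 2 (pmf (map_pmf g p) (g x)) - log 2 (pmf (map_pmf (\<lambda>x. (f x, g x)) p) (f x, g x)) \<partial>p)"
  for p :: "'o::finite pmf"
  by (simp add: cent_def ent_pmf integrable_measure_pmf_finite)

lemma pmf_map_Pair_le: "pmf (map_pmf (\<lambda>x. (f x, g x)) p) (a, b) \<le> pmf (map_pmf g p) b"
  unfolding pmf_map by (intro measure_pmf.finite_measure_mono) auto

lemma pmf_map_pos: "x \<in> set_pmf p \<Longrightarrow> 0 < pmf (map_pmf f p) (f x)"
  by (simp add: pmf_positive)

lemma cent_nonneg: "0 \<le> cent (pmf p) f g" for p :: "'o::finite pmf"
proof -
  have "(\<integral>x. 0 \<partial>p) \<le> cent (pmf p) f g"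
    unfolding cent_pmf
    by (intro expectation_mono_pmf)
      (auto intro!: log_mono pmf_map_Pair_le pmf_map_pos[where f = "\<lambda>x. (f x, g x)"])
  then show ?thesis by simp
qed

lemma expectation_log_conditional:
  fixes p :: "'o::finite pmf"
  shows "(\<integral>x. log 2 (pmf (map_pmf (\<lambda>x. (f x, g x)) p) (f x, g x) / pmf (map_pmf g p) (g x)) \<partial>p)
    = - cent (pmf p) f g"
proof -
  have "(\<integral>x. log 2 (pmf (map_pmf (\<lambda>x. (f x, g x)) p) (f x, g x) / pmf (map_pmf g p) (g x)) \<partial>p)
      = (\<integral>x. - (log 2 (pmf (map_pmf g p) (g x))
          - log 2 (pmf (map_pmf (\<lambda>x. (f x, g x)) p) (f x, g x))) \<partial>p)"
    using pmf_map_pos[of _ p g] pmf_map_pos[of _ p "\<lambda>x. (f x, g x)"]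
    by (intro integral_cong_AE AE_pmfI) (simp_all add: log_divide less_imp_neq[symmetric])
  also have "\<dots> = - cent (pmf p) f g"
    unfolding cent_pmf by (rule integral_minus)
  finally show ?thesis .
qed

lemma cmi_pmf:
  "cmi (pmf p) f g h = (\<integral>x. log 2 (pmf (map_pmf h p) (h x))
    - log 2 (pmf (map_pmf (\<lambda>x. (f x, h x)) p) (f x, h x))
    - log 2 (pmf (map_pmf (\<lambda>x. (g x, h x)) p) (g x, h x))
    + log 2 (pmf (map_pmf (\<lambda>x. (f x, g x, h x)) p) (f x, g x, h x)) \<partial>p)"
  for p :: "'o::finite pmf"
  by (simp add: cmi_def cent_pmf integrable_measure_pmf_finite)

lemma cmi_nonneg: "0 \<le> cmi (pmf p) f g h" for p :: "'o::finite pmf"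
proof -
  interpret information_space "measure_pmf p" 2
    by unfold_locales simp
  let ?law = "\<lambda>f. pmf (map_pmf f p)"
  let ?fh = "\<lambda>x. (f x, h x)" and ?gh = "\<lambda>x. (g x, h x)" and ?fgh = "\<lambda>x. (f x, g x, h x)"
  note pos = pmf_map_pos[of _ p h] pmf_map_pos[of _ p ?fh]
    pmf_map_pos[of _ p ?gh] pmf_map_pos[of _ p ?fgh]
  have simple: "simple_function (measure_pmf p) X" for X :: "'o \<Rightarrow> 'r"
    by (simp add: simple_function_def)
  have dist: "simple_distributed (measure_pmf p) X (?law X)" for X :: "'o \<Rightarrow> 'r"
    by (intro measure_pmf.simple_distributedI simple) (auto simp: pmf_map)
  let ?density = "\<lambda>a b c. log 2 (?law ?fgh (a, b, c) / (?law ?fh (a, c) * (?law ?gh (b, c) / ?law h c)))"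
  have "0 \<le> (\<Sum>(a, b, c)\<in>range ?fgh. ?law ?fgh (a, b, c) * ?density a b c)"
    using conditional_mutual_information_nonneg[OF simple simple simple, of f g h]
    unfolding conditional_mutual_information_eq[OF dist dist dist dist]
    by (simp only: space_measure_pmf)
  also have "\<dots> = (\<integral>(a, b, c). ?density a b c \<partial>map_pmf ?fgh p)"
    by (subst integral_measure_pmf[of "range ?fgh"]) (auto simp: case_prod_unfold)
  also have "\<dots> = cmi (pmf p) f g h"
    unfolding cmi_pmf integral_map_pmf
    by (intro integral_cong_AE AE_pmfI) (simp_all add: log_divide log_mult pos less_imp_neq[symmetric])
  finally show ?thesis .
qed

definition kernel_entropy :: "'z pmf \<Rightarrow> ('z \<Rightarrow> 'w pmf) \<Rightarrow> real" where
  "kernel_entropy Q K = - (\<integral>(w, z). log 2 (pmf (K z) w) \<partial>joint_pmf Q K)"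

text \<open>Given \<open>E\<close>, the auxiliary variable is independent of \<open>S\<close>.\<close>

lemma cmi_joint_pmf:
  fixes Q :: "'z::finite pmf" and k :: "'e \<Rightarrow> 'w::finite pmf" and E :: "'z \<Rightarrow> 'e" and S :: "'z \<Rightarrow> 's"
  defines "K \<equiv> \<lambda>z. k (E z)"
  defines "J \<equiv> joint_pmf Q K"
  shows "cmi (pmf J) (\<lambda>j. E (snd j)) fst (\<lambda>j. S (snd j))
    = cent (pmf J) fst (\<lambda>j. S (snd j)) - kernel_entropy Q K"
proof -
  let ?ES = "\<lambda>j. (E (snd j), S (snd j))" and ?EWS = "\<lambda>j. (E (snd j), fst j, S (snd j))"
  have J_EWS: "pmf (map_pmf ?EWS J) (e, w, s) = pmf (map_pmf ?ES J) (e, s) * pmf (k e) w" for e w s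
  proof -
    let ?R = "map_pmf (\<lambda>z. (E z, S z)) Q" and ?\<iota> = "\<lambda>(w, e, s). (e, w, s)"
    have "map_pmf ?EWS J = map_pmf ?\<iota> (joint_pmf ?R (\<lambda>(e, s). k e))"
      by (simp add: joint_pmf_map_pmf map_pmf_comp J_def K_def case_prod_unfold)
    then have "pmf (map_pmf ?EWS J) (e, w, s) = pmf (joint_pmf ?R (\<lambda>(e, s). k e)) (w, e, s)"
      using pmf_map_inj'[of ?\<iota> "joint_pmf ?R (\<lambda>(e, s). k e)" "(w, e, s)"] by (simp add: inj_def)
    also have "\<dots> = pmf ?R (e, s) * pmf (k e) w"
      by (simp add: pmf_joint_pmf)
    also have "?R = map_pmf ?ES J"
      using map_pmf_comp[of "\<lambda>z. (E z, S z)" snd J] by (simp add: J_def map_snd_joint_pmf)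
    finally show ?thesis .
  qed
  have log_EWS: "log 2 (pmf (map_pmf ?EWS J) (?EWS j))
      = log 2 (pmf (map_pmf ?ES J) (?ES j)) + log 2 (pmf (K (snd j)) (fst j))"
    if "j \<in> set_pmf J" for j
    using pmf_map_pos[OF that, of ?EWS] by (simp add: J_EWS K_def log_mult zero_less_mult_iff)
  let ?WS = "\<lambda>j. (fst j, S (snd j))"
  have "cmi (pmf J) (\<lambda>j. E (snd j)) fst (\<lambda>j. S (snd j))
      = (\<integral>j. (log 2 (pmf (map_pmf (\<lambda>j. S (snd j)) J) (S (snd j))) - log 2 (pmf (map_pmf ?WS J) (?WS j)))
        + log 2 (pmf (K (snd j)) (fst j)) \<partial>J)"
    unfolding cmi_pmf
    by (intro integral_cong_AE AE_pmfI) (simp_all add: log_EWS)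
  also have "\<dots> = cent (pmf J) fst (\<lambda>j. S (snd j)) - kernel_entropy Q K"
    by (simp add: cent_pmf kernel_entropy_def integrable_measure_pmf_finite J_def case_prod_unfold)
  finally show ?thesis .
qed

section \<open>I.i.d. blocks\<close>

primrec list_pmf :: "'a pmf list \<Rightarrow> 'a list pmf" where
  "list_pmf [] = return_pmf []"
| "list_pmf (p # ps) = bind_pmf p (\<lambda>x. map_pmf (\<lambda>xs. x # xs) (list_pmf ps))"

lemma finite_set_list_pmf:
  assumes "\<And>p. p \<in> set ps \<Longrightarrow> finite (set_pmf p)"
  shows "finite (set_pmf (list_pmf ps))"
  using assms by (induction ps) auto

lemma replicate_pmf_Suc:
  "replicate_pmf (Suc n) p = bind_pmf p (\<lambda>x. map_pmf (\<lambda>xs. x # xs) (replicate_pmf n p))"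
  by (simp add: map_pmf_def)

lemma finite_set_replicate_pmf:
  assumes "finite (set_pmf p)"
  shows "finite (set_pmf (replicate_pmf n p))"
  using finite_lists_length_eq[OF assms, of n] by (simp add: set_replicate_pmf lists_eq_set)

lemma pmf_bind_map_Cons:
  "pmf (bind_pmf p (\<lambda>x. map_pmf (\<lambda>xs. x # xs) q)) (y # ys) = pmf p y * pmf q ys"
proof -
  have "bind_pmf p (\<lambda>x. map_pmf (\<lambda>xs. x # xs) q) = map_pmf (\<lambda>(x, xs). x # xs) (pair_pmf p q)"
    by (simp add: pair_pmf_def map_pmf_def bind_assoc_pmf bind_return_pmf)
  moreover have "inj (\<lambda>(x, xs). x # xs)"
    by (auto simp: inj_def)
  ultimately show ?thesis
    using pmf_map_inj'[of "\<lambda>(x, xs). x # xs" "pair_pmf p q" "(y, ys)"] by (simp add: pmf_pair)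
qed

lemma pmf_replicate_pmf: "pmf (replicate_pmf (length xs) p) xs = prod_list (map (pmf p) xs)"
proof (induction xs)
  case (Cons x xs)
  then show ?case
    using pmf_bind_map_Cons[of p "replicate_pmf (length xs) p" x xs]
    by (simp add: replicate_pmf_Suc del: replicate_pmf.simps)
qed simp

lemma map_replicate_pmf: "map_pmf (map f) (replicate_pmf n p) = replicate_pmf n (map_pmf f p)"
proof (induction n)
  case (Suc n)
  show ?case
    by (simp add: replicate_pmf_Suc map_bind_pmf bind_map_pmf map_pmf_comp
        flip: Suc del: replicate_pmf.simps)
qed simp

lemma expectation_replicate_pmf_Suc:
  fixes f :: "'a list \<Rightarrow> real"
  assumes "finite (set_pmf p)"
  shows "(\<integral>xs. f xs \<partial>replicate_pmf (Suc n) p) = (\<integral>x. (\<integral>xs. f (x # xs) \<partial>replicate_pmf n p) \<partial>p)"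
  using assms
  by (simp only: replicate_pmf_Suc expectation_bind_pmf)
    (simp add: expectation_bind_pmf finite_set_replicate_pmf)

lemma expectation_sum_list_replicate_pmf:
  fixes g :: "'a \<Rightarrow> real"
  assumes p: "finite (set_pmf p)" and g: "(\<integral>x. g x \<partial>p) = 0"
  shows "(\<integral>xs. (\<Sum>x\<leftarrow>xs. g x) \<partial>replicate_pmf n p) = 0"
proof (induction n)
  case (Suc n)
  then show ?case
    using p g
    by (simp add: expectation_replicate_pmf_Suc integrable_measure_pmf_finite finite_set_replicate_pmf
        del: replicate_pmf.simps)
qed simp

lemma expectation_sum_list_squared_replicate_pmf:
  fixes g :: "'a \<Rightarrow> real"
  assumes p: "finite (set_pmf p)" and g: "(\<integral>x. g x \<partial>p) = 0"
  shows "(\<integral>xs. (\<Sum>x\<leftarrow>xs. g x)\<^sup>2 \<partial>replicate_pmf n p) = real n * (\<integral>x. (g x)\<^sup>2 \<partial>p)"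
proof (induction n)
  case (Suc n)
  let ?R = "replicate_pmf n p" and ?S = "\<lambda>xs. \<Sum>x\<leftarrow>xs. g x"
  have "(\<integral>xs. (?S xs)\<^sup>2 \<partial>replicate_pmf (Suc n) p)
      = (\<integral>x. (\<integral>xs. (g x)\<^sup>2 + 2 * g x * ?S xs + (?S xs)\<^sup>2 \<partial>?R) \<partial>p)"
    using p by (simp add: expectation_replicate_pmf_Suc power2_sum add_ac mult_ac del: replicate_pmf.simps)
  also have "\<dots> = (\<integral>x. (g x)\<^sup>2 + (\<integral>xs. (?S xs)\<^sup>2 \<partial>?R) \<partial>p)"
    using p g
    by (simp add: integrable_measure_pmf_finite finite_set_replicate_pmf expectation_sum_list_replicate_pmf)
  also have "\<dots> = (\<integral>x. (g x)\<^sup>2 \<partial>p) + (\<integral>xs. (?S xs)\<^sup>2 \<partial>?R)"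
    using p by (simp add: integrable_measure_pmf_finite)
  finally show ?case using Suc by (simp add: algebra_simps)
qed simp

lemma weak_law_of_large_numbers_pmf:
  fixes g :: "'a \<Rightarrow> real"
  assumes p: "finite (set_pmf p)" and \<alpha>: "\<alpha> < (\<integral>x. g x \<partial>p)"
  shows "(\<lambda>n. measure (replicate_pmf n p) {xs. (\<Sum>x\<leftarrow>xs. g x) < real n * \<alpha>}) \<longlonglongrightarrow> 0"
proof -
  define \<mu> where "\<mu> = (\<integral>x. g x \<partial>p)"
  define V where "V = (\<integral>x. (g x - \<mu>)\<^sup>2 \<partial>p)"
  let ?P = "\<lambda>n. measure (replicate_pmf n p) {xs. (\<Sum>x\<leftarrow>xs. g x) < real n * \<alpha>}"
  have centered: "(\<integral>x. g x - \<mu> \<partial>p) = 0"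
    using p by (simp add: integrable_measure_pmf_finite \<mu>_def)
  have bound: "?P n \<le> V / (\<mu> - \<alpha>)\<^sup>2 / real n" if n: "0 < n" for n
  proof -
    let ?R = "replicate_pmf n p" and ?S = "\<lambda>xs. \<Sum>x\<leftarrow>xs. g x - \<mu>"
    have R: "finite (set_pmf ?R)"
      using p by (rule finite_set_replicate_pmf)
    have "?P n \<le> measure ?R {xs. real n * (\<mu> - \<alpha>) \<le> \<bar>?S xs\<bar>}"
    proof (rule prob_mono_pmf)
      fix xs assume "xs \<in> set_pmf ?R" and "(\<Sum>x\<leftarrow>xs. g x) < real n * \<alpha>"
      then show "real n * (\<mu> - \<alpha>) \<le> \<bar>?S xs\<bar>"
        by (simp add: set_replicate_pmf sum_list_subtractf sum_list_triv algebra_simps)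
    qed
    also have "\<dots> \<le> (\<integral>xs. (?S xs)\<^sup>2 \<partial>?R) / (real n * (\<mu> - \<alpha>))\<^sup>2"
      using measure_pmf.second_moment_method[of ?S ?R "real n * (\<mu> - \<alpha>)"] n \<alpha> R
      by (simp add: integrable_measure_pmf_finite \<mu>_def)
    also have "\<dots> = V / (\<mu> - \<alpha>)\<^sup>2 / real n"
      unfolding expectation_sum_list_squared_replicate_pmf[OF p centered] V_def
      using n by (simp add: power2_eq_square)
    finally show ?thesis .
  qed
  show ?thesis
  proof (rule tendsto_sandwich[OF _ _ tendsto_const lim_const_over_n])
    show "\<forall>\<^sub>F n in sequentially. ?P n \<le> V / (\<mu> - \<alpha>)\<^sup>2 / real n"
      by (rule eventually_mono[OF eventually_gt_at_top[of 0] bound])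
  qed simp
qed

lemma prod_list_map_pos:
  fixes f :: "'a \<Rightarrow> 'b::linordered_semidom"
  assumes "\<And>x. x \<in> set xs \<Longrightarrow> 0 < f x"
  shows "0 < prod_list (map f xs)"
  using assms by (induction xs) auto

lemma log_prod_list_map:
  assumes "\<And>x. x \<in> set xs \<Longrightarrow> 0 < f x"
  shows "log b (prod_list (map f xs)) = (\<Sum>x\<leftarrow>xs. log b (f x))"
  using assms
proof (induction xs)
  case (Cons x xs)
  have "0 < f x" "0 < prod_list (map f xs)"
    using Cons.prems by (auto intro!: prod_list_map_pos)
  with Cons show ?case
    by (simp add: log_mult less_imp_neq[symmetric])
qed simp

lemma prob_prod_list_less_tendsto_0:
  fixes \<phi> :: "'a \<Rightarrow> real"
  assumes p: "finite (set_pmf p)" and pos: "\<And>x. x \<in> set_pmf p \<Longrightarrow> 0 < \<phi> x"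
    and \<beta>: "\<beta> < (\<integral>x. log 2 (\<phi> x) \<partial>p)"
  shows "(\<lambda>n. measure (replicate_pmf n p) {xs. prod_list (map \<phi> xs) < 2 powr (real n * \<beta>)}) \<longlonglongrightarrow> 0"
proof (rule tendsto_sandwich[OF _ _ tendsto_const weak_law_of_large_numbers_pmf[OF p \<beta>]])
  have "(\<Sum>x\<leftarrow>xs. log 2 (\<phi> x)) < real n * \<beta>"
    if xs: "xs \<in> set_pmf (replicate_pmf n p)" "prod_list (map \<phi> xs) < 2 powr (real n * \<beta>)" for xs n
  proof -
    have "0 < \<phi> x" if "x \<in> set xs" for x
      using that xs(1) pos by (auto simp: set_replicate_pmf)
    then have log: "log 2 (prod_list (map \<phi> xs)) = (\<Sum>x\<leftarrow>xs. log 2 (\<phi> x))"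
      and prod: "0 < prod_list (map \<phi> xs)"
      by (simp_all add: log_prod_list_map prod_list_map_pos)
    have "log 2 (prod_list (map \<phi> xs)) < log 2 (2 powr (real n * \<beta>))"
      using xs(2) prod by (intro log_less) auto
    then show ?thesis by (simp add: log)
  qed
  then show "\<forall>\<^sub>F n in sequentially.
      measure (replicate_pmf n p) {xs. prod_list (map \<phi> xs) < 2 powr (real n * \<beta>)}
      \<le> measure (replicate_pmf n p) {xs. (\<Sum>x\<leftarrow>xs. log 2 (\<phi> x)) < real n * \<beta>}"
    by (intro always_eventually allI prob_mono_pmf)
qed simp

lemma prod_list_map_divide:
  fixes f g :: "'a \<Rightarrow> 'b::field"
  shows "prod_list (map (\<lambda>x. f x / g x) xs) = prod_list (map f xs) / prod_list (map g xs)"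
  by (induction xs) simp_all

lemma unlikely_prob_map_pmf: "unlikely_prob (map_pmf \<phi> P) X S \<delta> = unlikely_prob P (X \<circ> \<phi>) (S \<circ> \<phi>) \<delta>"
  by (simp add: unlikely_prob_def likely_set_def map_pmf_comp vimage_def comp_def)

lemma unlikely_prob_relabel:
  assumes "inj \<iota>"
  shows "unlikely_prob P X (\<lambda>\<omega>. \<iota> (S \<omega>)) \<delta> = unlikely_prob P X S \<delta>"
proof -
  have "pmf (map_pmf (\<lambda>\<omega>. \<iota> (S \<omega>)) P) (\<iota> s) = pmf (map_pmf S P) s" for s
    using pmf_map_inj'[OF assms, of "map_pmf S P" s] by (simp add: map_pmf_comp)
  moreover have "pmf (map_pmf (\<lambda>\<omega>. (X \<omega>, \<iota> (S \<omega>))) P) (a, \<iota> s)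
      = pmf (map_pmf (\<lambda>\<omega>. (X \<omega>, S \<omega>)) P) (a, s)" for a s
    using pmf_map_inj'[of "map_prod id \<iota>" "map_pmf (\<lambda>\<omega>. (X \<omega>, S \<omega>)) P" "(a, s)"] assms
    by (simp add: map_pmf_comp prod.inj_map)
  ultimately show ?thesis
    by (simp add: unlikely_prob_def likely_set_def)
qed

lemma pmf_map_replicate_pmf:
  assumes "length xs = n"
  shows "pmf (map_pmf (map f) (replicate_pmf n p)) (map f xs) = (\<Prod>x\<leftarrow>xs. pmf (map_pmf f p) (f x))"
  using pmf_replicate_pmf[of "map f xs" "map_pmf f p"] assms by (simp add: map_replicate_pmf comp_def)

lemma inj_unzip: "inj (\<lambda>l. (map fst l, map snd l))"
  by (rule inj_on_inverseI[where g = "\<lambda>(as, bs). zip as bs"]) (simp add: zip_map_fst_snd)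

lemma pmf_map_Pair_replicate_pmf:
  assumes "length xs = n"
  shows "pmf (map_pmf (\<lambda>xs. (map f xs, map g xs)) (replicate_pmf n p)) (map f xs, map g xs)
    = (\<Prod>x\<leftarrow>xs. pmf (map_pmf (\<lambda>x. (f x, g x)) p) (f x, g x))"
  using pmf_map_inj'[OF inj_unzip,
      of "map_pmf (map (\<lambda>x. (f x, g x))) (replicate_pmf n p)" "map (\<lambda>x. (f x, g x)) xs"]
    pmf_map_replicate_pmf[OF assms, of "\<lambda>x. (f x, g x)" p]
  by (simp add: map_pmf_comp comp_def)

lemma unlikely_prob_replicate_pmf:
  "unlikely_prob (replicate_pmf n p) (map f) (map g) \<delta>
    = measure (replicate_pmf n p)
      {xs. (\<Prod>x\<leftarrow>xs. pmf (map_pmf (\<lambda>x. (f x, g x)) p) (f x, g x) / pmf (map_pmf g p) (g x)) < \<delta>}"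
  unfolding unlikely_prob_eq
proof (rule prob_cong_pmf)
  fix xs assume "xs \<in> set_pmf (replicate_pmf n p)"
  then have "length xs = n" "0 < (\<Prod>x\<leftarrow>xs. pmf (map_pmf g p) (g x))"
    by (auto simp: set_replicate_pmf intro!: prod_list_map_pos pmf_map_pos)
  then show "pmf (map_pmf (\<lambda>xs. (map f xs, map g xs)) (replicate_pmf n p)) (map f xs, map g xs)
      < \<delta> * pmf (map_pmf (map g) (replicate_pmf n p)) (map g xs)
    \<longleftrightarrow> (\<Prod>x\<leftarrow>xs. pmf (map_pmf (\<lambda>x. (f x, g x)) p) (f x, g x) / pmf (map_pmf g p) (g x)) < \<delta>"
    by (simp add: pmf_map_Pair_replicate_pmf pmf_map_replicate_pmf prod_list_map_divide pos_divide_less_eq)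
qed

theorem asymptotic_equipartition:
  fixes p :: "'o::finite pmf"
  assumes "cent (pmf p) f g < \<alpha>"
  shows "(\<lambda>n. unlikely_prob (replicate_pmf n p) (map f) (map g) (2 powr (- real n * \<alpha>))) \<longlonglongrightarrow> 0"
proof -
  let ?ratio = "\<lambda>x. pmf (map_pmf (\<lambda>x. (f x, g x)) p) (f x, g x) / pmf (map_pmf g p) (g x)"
  have "(\<lambda>n. measure (replicate_pmf n p) {xs. (\<Prod>x\<leftarrow>xs. ?ratio x) < 2 powr (real n * - \<alpha>)}) \<longlonglongrightarrow> 0"
  proof (rule prob_prod_list_less_tendsto_0)
    show "0 < ?ratio x" if "x \<in> set_pmf p" for x
      using pmf_map_pos[OF that, of g] pmf_map_pos[OF that, of "\<lambda>x. (f x, g x)"] by simp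
    show "- \<alpha> < (\<integral>x. log 2 (?ratio x) \<partial>p)"
      using assms by (simp add: expectation_log_conditional)
  qed simp
  then show ?thesis
    by (simp add: unlikely_prob_replicate_pmf)
qed

abbreviation block_kernel :: "('z \<Rightarrow> 'w pmf) \<Rightarrow> 'z list \<Rightarrow> 'w list pmf" where
  "block_kernel K zs \<equiv> list_pmf (map K zs)"

lemma joint_pmf_replicate_pmf:
  "joint_pmf (replicate_pmf n Q) (block_kernel K)
    = map_pmf (\<lambda>js. (map fst js, map snd js)) (replicate_pmf n (joint_pmf Q K))"
proof (induction n)
  case (Suc n)
  let ?L = "block_kernel K"
  have "joint_pmf (replicate_pmf (Suc n) Q) ?L
      = do {z \<leftarrow> Q; zs \<leftarrow> replicate_pmf n Q; w \<leftarrow> K z; ws \<leftarrow> ?L zs; return_pmf (w # ws, z # zs)}"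
    by (simp add: joint_pmf_def map_pmf_def bind_assoc_pmf bind_return_pmf)
  also have "\<dots> = do {z \<leftarrow> Q; w \<leftarrow> K z; zs \<leftarrow> replicate_pmf n Q; ws \<leftarrow> ?L zs; return_pmf (w # ws, z # zs)}"
    by (subst bind_commute_pmf[of _ "K _"]) (rule refl)
  also have "\<dots> = do {(w, z) \<leftarrow> joint_pmf Q K;
      (ws, zs) \<leftarrow> joint_pmf (replicate_pmf n Q) ?L; return_pmf (w # ws, z # zs)}"
    by (simp add: joint_pmf_def map_pmf_def bind_assoc_pmf bind_return_pmf)
  also have "\<dots> = map_pmf (\<lambda>js. (map fst js, map snd js)) (replicate_pmf (Suc n) (joint_pmf Q K))"
    by (simp add: Suc map_pmf_def bind_assoc_pmf bind_return_pmf case_prod_unfold)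
  finally show ?case .
qed (simp add: joint_pmf_def map_pmf_def bind_return_pmf)

lemma pmf_block_kernel: "pmf (block_kernel K (map snd js)) (map fst js) = (\<Prod>(w, z)\<leftarrow>js. pmf (K z) w)"
  by (induction js) (simp_all add: pmf_bind_map_Cons case_prod_unfold)

lemma heavy_prob_replicate_pmf:
  assumes "0 < \<tau>"
  shows "heavy_prob (replicate_pmf n Q) (block_kernel K) \<tau>
    = measure (replicate_pmf n (joint_pmf Q K)) {js. (\<Prod>(w, z)\<leftarrow>js. 1 / pmf (K z) w) < 1 / \<tau>}"
  unfolding heavy_prob_def joint_pmf_replicate_pmf measure_map_pmf vimage_Collect_eq prod.case
proof (rule prob_cong_pmf)
  fix js assume "js \<in> set_pmf (replicate_pmf n (joint_pmf Q K))"
  then have "0 < (\<Prod>(w, z)\<leftarrow>js. pmf (K z) w)"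
    by (intro prod_list_map_pos) (auto simp: set_replicate_pmf set_joint_pmf pmf_positive)
  moreover have "(\<Prod>(w, z)\<leftarrow>js. 1 / pmf (K z) w) = 1 / (\<Prod>(w, z)\<leftarrow>js. pmf (K z) w)"
    by (induction js) auto
  ultimately show "\<tau> < pmf (block_kernel K (map snd js)) (map fst js)
    \<longleftrightarrow> (\<Prod>(w, z)\<leftarrow>js. 1 / pmf (K z) w) < 1 / \<tau>"
    using assms by (simp only: pmf_block_kernel) (simp add: field_simps)
qed

lemma heavy_prob_tendsto_0:
  fixes Q :: "'z pmf" and K :: "'z \<Rightarrow> 'w pmf"
  assumes Q: "finite (set_pmf Q)" and K: "\<And>z. finite (set_pmf (K z))" and \<beta>: "\<beta> < kernel_entropy Q K"
  shows "(\<lambda>n. heavy_prob (replicate_pmf n Q) (block_kernel K) (2 powr (- real n * \<beta>))) \<longlonglongrightarrow> 0"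
proof -
  let ?J = "joint_pmf Q K" and ?inverse = "\<lambda>(w, z). 1 / pmf (K z) w"
  have "(\<lambda>n. measure (replicate_pmf n ?J) {js. (\<Prod>j\<leftarrow>js. ?inverse j) < 2 powr (real n * \<beta>)}) \<longlonglongrightarrow> 0"
  proof (rule prob_prod_list_less_tendsto_0)
    have "(\<integral>j. log 2 (?inverse j) \<partial>?J) = (\<integral>j. - (case j of (w, z) \<Rightarrow> log 2 (pmf (K z) w)) \<partial>?J)"
      by (intro integral_cong_AE AE_pmfI) (auto simp: log_divide set_joint_pmf pmf_positive_iff[symmetric])
    then show "\<beta> < (\<integral>j. log 2 (?inverse j) \<partial>?J)"
      using \<beta> by (simp add: kernel_entropy_def)
  qed (use finite_set_joint_pmf[OF Q K] in \<open>auto simp: set_joint_pmf pmf_positive\<close>)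
  then show ?thesis
    by (simp add: heavy_prob_replicate_pmf powr_minus_divide)
qed

section \<open>Achievable rates\<close>

definition codebook_size :: "real \<Rightarrow> nat \<Rightarrow> nat" where
  "codebook_size r n = nat \<lceil>2 powr (real n * r)\<rceil>"

lemma codebook_size_pos: "1 \<le> codebook_size r n"
proof -
  have "0 < \<lceil>2 powr (real n * r)\<rceil>" by simp
  then show ?thesis unfolding codebook_size_def by linarith
qed

lemma codebook_size_bounds:
  "2 powr (real n * r) \<le> real (codebook_size r n)"
  "real (codebook_size r n) \<le> 2 powr (real n * r) + 1"
proof -
  have "real (codebook_size r n) = of_int \<lceil>2 powr (real n * r)\<rceil>"
    by (simp add: codebook_size_def less_imp_le)
  then show "2 powr (real n * r) \<le> real (codebook_size r n)"
      "real (codebook_size r n) \<le> 2 powr (real n * r) + 1"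
    by linarith+
qed

lemma log_codebook_size_le:
  assumes "0 \<le> r" and "0 < n"
  shows "log 2 (real (codebook_size r n)) / real n \<le> r + 1 / real n"
proof -
  have "1 \<le> 2 powr (real n * r)"
    using assms by (simp add: ge_one_powr_ge_zero)
  then have "real (codebook_size r n) \<le> 2 powr (real n * r + 1)"
    using codebook_size_bounds(2)[of r n] by (simp add: powr_add)
  then have "log 2 (real (codebook_size r n)) \<le> log 2 (2 powr (real n * r + 1))"
    using codebook_size_pos[of r n] by (intro log_mono) auto
  then show ?thesis using assms(2) by (simp add: field_simps)
qed

lemma powr_nat_mult_tendsto_0:
  fixes a :: real
  assumes "a < 0"
  shows "(\<lambda>n. 2 powr (real n * a)) \<longlonglongrightarrow> 0"
proof -
  have "(\<lambda>n. (2 powr a) ^ n) \<longlonglongrightarrow> 0"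
    using assms by (intro LIMSEQ_power_zero) (simp add: powr_less_one)
  also have "(\<lambda>n. (2 powr a) ^ n) = (\<lambda>n. 2 powr (real n * a))"
    by (simp add: powr_realpow[symmetric] powr_powr mult.commute)
  finally show ?thesis .
qed

lemma binning_bound_replicate_tendsto_0:
  fixes p :: "'o::finite pmf"
  assumes "cent (pmf p) f g < \<alpha>" and "\<alpha> < r" and M: "\<And>n. 2 powr (real n * r) \<le> M n"
  shows "(\<lambda>n. binning_bound (replicate_pmf n p) (map f) (map g) (2 powr (- real n * \<alpha>)) (M n)) \<longlonglongrightarrow> 0"
proof -
  have M_pos: "0 < M n" for n
    by (rule less_le_trans[OF _ M]) simp
  have "1 / (M n * 2 powr (- real n * \<alpha>)) \<le> 2 powr (real n * (\<alpha> - r))" for n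
  proof -
    have "1 / (M n * 2 powr (- real n * \<alpha>)) \<le> 1 / (2 powr (real n * r) * 2 powr (- real n * \<alpha>))"
      using M[of n] M_pos[of n] by (intro divide_left_mono mult_right_mono mult_pos_pos) auto
    also have "\<dots> = 2 powr (real n * (\<alpha> - r))"
      by (simp add: powr_add[symmetric] powr_minus_divide[symmetric] algebra_simps)
    finally show ?thesis .
  qed
  moreover have "0 \<le> 1 / (M n * 2 powr (- real n * \<alpha>))" for n
    using M_pos[of n] by simp
  ultimately have "(\<lambda>n. 1 / (M n * 2 powr (- real n * \<alpha>))) \<longlonglongrightarrow> 0"
    using assms(2)
    by (intro tendsto_sandwich[OF _ _ tendsto_const powr_nat_mult_tendsto_0[of "\<alpha> - r"]]) auto
  then show ?thesis
    unfolding binning_bound_def using tendsto_add[OF asymptotic_equipartition[OF assms(1)]] by fastforce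
qed

lemma receiver_bound_replicate_tendsto_0:
  fixes p :: "'o::finite pmf"
  assumes W: "cent (pmf p) W S < \<alpha>" "\<alpha> < r" "\<And>n. 2 powr (real n * r) \<le> N n"
    and X: "cent (pmf p) X (\<lambda>\<omega>. (W \<omega>, S \<omega>)) < \<beta>" "\<beta> < s" "\<And>n. 2 powr (real n * s) \<le> M n"
  shows "(\<lambda>n. receiver_bound (replicate_pmf n p) (map W) (map X) (map S)
    (2 powr (- real n * \<alpha>)) (2 powr (- real n * \<beta>)) (N n) (M n)) \<longlonglongrightarrow> 0"
proof -
  have "binning_bound P (map X) (\<lambda>\<omega>s. (map W \<omega>s, map S \<omega>s)) \<delta> m
      = binning_bound P (map X) (map (\<lambda>\<omega>. (W \<omega>, S \<omega>))) \<delta> m" for P \<delta> m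
    using unlikely_prob_relabel[OF inj_unzip, of P "map X" "map (\<lambda>\<omega>. (W \<omega>, S \<omega>))" \<delta>]
    by (simp add: binning_bound_def comp_def)
  then show ?thesis
    using tendsto_add[OF binning_bound_replicate_tendsto_0[OF W] binning_bound_replicate_tendsto_0[OF X]]
    by (simp add: receiver_bound_def)
qed

lemma receiver_bound_joint_replicate:
  "receiver_bound (joint_pmf (replicate_pmf n Q) (block_kernel K))
      fst (\<lambda>j. map X (snd j)) (\<lambda>j. map S (snd j)) \<delta> \<epsilon> N M
    = receiver_bound (replicate_pmf n (joint_pmf Q K))
      (map fst) (map (\<lambda>j. X (snd j))) (map (\<lambda>j. S (snd j))) \<delta> \<epsilon> N M"
  by (simp add: joint_pmf_replicate_pmf receiver_bound_def binning_bound_def unlikely_prob_map_pmf comp_def)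

lemma bias_bound_replicate_tendsto_0:
  fixes Q :: "'z pmf" and K :: "'z \<Rightarrow> 'w pmf"
  assumes Q: "finite (set_pmf Q)" and K: "\<And>z. finite (set_pmf (K z))"
    and \<beta>: "\<rho> < \<beta>" "\<beta> < kernel_entropy Q K"
  shows "(\<lambda>n. bias_bound (replicate_pmf n Q) (block_kernel K)
    (2 powr (- real n * \<beta>)) (real (codebook_size \<rho> n))) \<longlonglongrightarrow> 0"
proof -
  let ?excess = "\<lambda>n. (real (codebook_size \<rho> n) - 1) * 2 powr (- real n * \<beta>)"
  have "?excess \<longlonglongrightarrow> 0"
  proof (rule tendsto_sandwich[OF _ _ tendsto_const powr_nat_mult_tendsto_0])
    show "\<rho> - \<beta> < 0" using \<beta>(1) by simp
    have "?excess n \<le> 2 powr (real n * \<rho>) * 2 powr (- real n * \<beta>)" for n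
      using codebook_size_bounds(2)[of \<rho> n] by (intro mult_right_mono) auto
    then show "\<forall>\<^sub>F n in sequentially. ?excess n \<le> 2 powr (real n * (\<rho> - \<beta>))"
      by (simp add: powr_add[symmetric] algebra_simps)
    show "\<forall>\<^sub>F n in sequentially. 0 \<le> ?excess n"
      using codebook_size_pos[of \<rho>] by simp
  qed
  then have "(\<lambda>n. sqrt (?excess n)) \<longlonglongrightarrow> 0"
    using tendsto_real_sqrt by fastforce
  then show ?thesis
    unfolding bias_bound_def
    using tendsto_add[OF tendsto_mult_left[OF heavy_prob_tendsto_0[OF Q K \<beta>(2)], of 2]] by fastforce
qed

definition has_code ::
    "('x::finite \<times> 'y::finite \<times> 'u::finite \<times> 'v::finite) pmf
      \<Rightarrow> nat \<Rightarrow> real \<Rightarrow> real \<times> real \<times> real \<Rightarrow> bool" where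
  "has_code Q n \<epsilon> R \<longleftrightarrow> (case R of (R0, R1, R2) \<Rightarrow> \<exists>m0 m1 m2 e dx dy. is_code n m0 m1 m2 e \<and>
     max (err_x Q n e dx) (err_y Q n e dy) \<le> \<epsilon> \<and>
     log 2 (real m0) / real n \<le> R0 + \<epsilon> \<and>
     log 2 (real m1) / real n \<le> R1 + \<epsilon> \<and>
     log 2 (real m2) / real n \<le> R2 + \<epsilon>)"

lemma achievable_iff: "achievable Q R \<longleftrightarrow> (\<forall>\<epsilon>>0. \<forall>\<^sub>F n in sequentially. has_code Q n \<epsilon> R)"
  by (auto simp: achievable_def has_code_def eventually_sequentially)

lemma has_code_mono:
  assumes "has_code Q n \<epsilon> (S0, S1, S2)" and "\<epsilon> \<le> \<delta>"
    and "S0 + \<epsilon> \<le> R0 + \<delta>" "S1 + \<epsilon> \<le> R1 + \<delta>" "S2 + \<epsilon> \<le> R2 + \<delta>"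
  shows "has_code Q n \<delta> (R0, R1, R2)"
  using assms unfolding has_code_def prod.case by (meson order_trans)

lemma closed_achievable: "closed {R. achievable Q R}"
  unfolding closure_subset_eq[symmetric]
proof clarify
  fix R0 R1 R2 assume closure: "(R0, R1, R2) \<in> closure {R. achievable Q R}"
  show "achievable Q (R0, R1, R2)"
    unfolding achievable_iff
  proof (intro allI impI)
    fix \<epsilon> :: real assume \<epsilon>: "0 < \<epsilon>"
    then obtain S0 S1 S2 where S: "achievable Q (S0, S1, S2)"
      and near: "dist (S0, S1, S2) (R0, R1, R2) < \<epsilon> / 2"
      using closure unfolding closure_approachable by (metis half_gt_zero mem_Collect_eq prod_cases3)
    have "dist S0 R0 < \<epsilon> / 2" "dist (S1, S2) (R1, R2) < \<epsilon> / 2"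
      using dist_fst_le[of "(S0, S1, S2)" "(R0, R1, R2)"]
        dist_snd_le[of "(S0, S1, S2)" "(R0, R1, R2)"] near by auto
    moreover from this have "dist S1 R1 < \<epsilon> / 2" "dist S2 R2 < \<epsilon> / 2"
      using dist_fst_le[of "(S1, S2)" "(R1, R2)"] dist_snd_le[of "(S1, S2)" "(R1, R2)"] by auto
    ultimately have "S0 + \<epsilon> / 2 \<le> R0 + \<epsilon>" "S1 + \<epsilon> / 2 \<le> R1 + \<epsilon>" "S2 + \<epsilon> / 2 \<le> R2 + \<epsilon>"
      unfolding dist_real_def by linarith+
    moreover have "\<forall>\<^sub>F n in sequentially. has_code Q n (\<epsilon> / 2) (S0, S1, S2)"
      using S \<epsilon> by (simp add: achievable_iff)
    ultimately show "\<forall>\<^sub>F n in sequentially. has_code Q n \<epsilon> (R0, R1, R2)"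
      using \<epsilon> by (auto elim!: eventually_mono intro: has_code_mono)
  qed
qed

definition source_x :: "'x \<times> 'y \<times> 'u \<times> 'v \<Rightarrow> 'x" where "source_x = fst"
definition source_y :: "'x \<times> 'y \<times> 'u \<times> 'v \<Rightarrow> 'y" where "source_y = fst \<circ> snd"
definition side_u :: "'x \<times> 'y \<times> 'u \<times> 'v \<Rightarrow> 'u" where "side_u = fst \<circ> snd \<circ> snd"
definition side_v :: "'x \<times> 'y \<times> 'u \<times> 'v \<Rightarrow> 'v" where "side_v = snd \<circ> snd \<circ> snd"

definition source_xy :: "'x \<times> 'y \<times> 'u \<times> 'v \<Rightarrow> 'x \<times> 'y" where
  "source_xy z = (source_x z, source_y z)"

lemmas source_defs = source_x_def source_y_def source_xy_def side_u_def side_v_def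

lemma sum_iid_prob:
  fixes Q :: "'z::finite pmf"
  shows "(\<Sum>zs\<in>{zs. length zs = n}. if P zs then iid_prob Q zs else 0)
    = measure (replicate_pmf n Q) {zs. P zs}"
proof -
  let ?A = "{zs :: 'z list. length zs = n}" and ?Qn = "replicate_pmf n Q"
  have fin: "finite ?A"
    using finite_lists_length_eq[of "UNIV :: 'z set" n] by simp
  have "(\<Sum>zs\<in>?A. if P zs then iid_prob Q zs else 0) = (\<Sum>zs\<in>?A. if P zs then pmf ?Qn zs else 0)"
    by (intro sum.cong) (auto simp: iid_prob_def pmf_replicate_pmf)
  also have "\<dots> = (\<Sum>zs\<in>{zs \<in> ?A. P zs}. pmf ?Qn zs)"
    using fin by (rule sum.inter_filter[symmetric])
  also have "\<dots> = measure ?Qn {zs \<in> ?A. P zs}"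
    using fin by (intro measure_measure_pmf_finite[symmetric]) simp
  also have "\<dots> = measure ?Qn {zs. P zs}"
    by (rule prob_cong_pmf) (simp add: set_replicate_pmf)
  finally show ?thesis .
qed

lemma err_x_eq_prob:
  "err_x Q n e dx = measure (replicate_pmf n Q)
     {zs. case e (map source_x zs) (map source_y zs) of (a, b, c) \<Rightarrow>
     dx a b (map side_u zs) \<noteq> map source_x zs}"
  unfolding err_x_def sum_iid_prob[symmetric] Let_def source_defs
  by (intro sum.cong) (auto split: prod.split)

lemma err_y_eq_prob:
  "err_y Q n e dy = measure (replicate_pmf n Q)
     {zs. case e (map source_x zs) (map source_y zs) of (a, b, c) \<Rightarrow>
     dy a c (map side_v zs) \<noteq> map source_y zs}"
  unfolding err_y_def sum_iid_prob[symmetric] Let_def source_defs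
  by (intro sum.cong) (auto split: prod.split)

lemma max_err_le_sum: "max (err_x Q n e dx) (err_y Q n e dy) \<le> err_x Q n e dx + err_y Q n e dy"
  by (simp add: err_x_eq_prob err_y_eq_prob)

definition kernel_pmf :: "('x \<Rightarrow> 'y \<Rightarrow> 'w \<Rightarrow> real) \<Rightarrow> 'x \<times> 'y \<Rightarrow> 'w pmf" where
  "kernel_pmf c = (\<lambda>(x, y). embed_pmf (c x y))"

lemma pmf_kernel_pmf:
  fixes c :: "'x \<Rightarrow> 'y \<Rightarrow> 'w::finite \<Rightarrow> real"
  assumes "c \<in> cond_kernels"
  shows "pmf (kernel_pmf c (x, y)) w = c x y w"
proof -
  have "(\<integral>\<^sup>+w. ennreal (c x y w) \<partial>count_space UNIV) = ennreal (\<Sum>w\<in>UNIV. c x y w)"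
    using assms by (simp add: nn_integral_count_space_finite cond_kernels_def sum_ennreal)
  then show ?thesis
    using assms by (simp add: kernel_pmf_def pmf_embed_pmf cond_kernels_def)
qed

lemma joint_p_eq_pmf:
  fixes c :: "'x \<Rightarrow> 'y \<Rightarrow> 'w::finite \<Rightarrow> real"
  assumes "c \<in> cond_kernels"
  shows "joint_p c Q = pmf (joint_pmf Q (\<lambda>z. kernel_pmf c (source_xy z)))"
  by (auto simp: fun_eq_iff joint_p_def pmf_joint_pmf pmf_kernel_pmf[OF assms] source_defs mult.commute
      split: prod.split)

lemma exists_block_code:
  fixes Q :: "('x::finite \<times> 'y::finite \<times> 'u::finite \<times> 'v::finite) pmf"
    and k :: "'x \<times> 'y \<Rightarrow> 'w::finite pmf"
    and n m m0 m1 m2 :: nat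
  assumes m: "1 \<le> m" "1 \<le> m0" "1 \<le> m1" "1 \<le> m2" and pos: "0 < \<delta>" "0 < \<delta>x" "0 < \<delta>y" "0 \<le> \<tau>"
  defines "K \<equiv> \<lambda>z. k (source_xy z)"
  defines "Jn \<equiv> replicate_pmf n (joint_pmf Q K)" and "N \<equiv> real m * real m0"
  obtains e dx dy where "is_code n m0 m1 m2 e"
    and "err_x Q n e dx + err_y Q n e dy
      \<le> receiver_bound Jn (map fst) (map (\<lambda>j. source_x (snd j))) (map (\<lambda>j. side_u (snd j)))
          \<delta> \<delta>x N (real m1)
      + receiver_bound Jn (map fst) (map (\<lambda>j. source_y (snd j))) (map (\<lambda>j. side_v (snd j)))
          \<delta> \<delta>y N (real m2)
      + 2 * bias_bound (replicate_pmf n Q) (block_kernel K) \<tau> (real m)"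
proof -
  let ?Qn = "replicate_pmf n Q"
  have fin: "finite (set_pmf ?Qn)" "\<And>es. finite (set_pmf (block_kernel k es))"
    by (simp_all add: finite_set_replicate_pmf finite_set_list_pmf)
  have bins: "finite {1..j}" "{1..j} \<noteq> {}" if "1 \<le> j" for j :: nat
    using that by simp_all
  let ?J = "joint_pmf ?Qn (\<lambda>zs. block_kernel k (map source_xy zs))"
  obtain enc hx hy dx dy where ranges: "range enc \<subseteq> {1..m0}" "range hx \<subseteq> {1..m1}" "range hy \<subseteq> {1..m2}"
    and error: "measure ?Qn
          {zs. dx (enc (map source_xy zs)) (hx (map source_x zs)) (map side_u zs) \<noteq> map source_x zs}
        + measure ?Qn
          {zs. dy (enc (map source_xy zs)) (hy (map source_y zs)) (map side_v zs) \<noteq> map source_y zs}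
      \<le> receiver_bound ?J fst (\<lambda>j. map source_x (snd j)) (\<lambda>j. map side_u (snd j)) \<delta> \<delta>x
          (real (card {1..m}) * real (card {1..m0})) (real (card {1..m1}))
        + receiver_bound ?J fst (\<lambda>j. map source_y (snd j)) (\<lambda>j. map side_v (snd j)) \<delta> \<delta>y
          (real (card {1..m}) * real (card {1..m0})) (real (card {1..m2}))
        + 2 * bias_bound ?Qn (\<lambda>zs. block_kernel k (map source_xy zs)) \<tau> (real (card {1..m}))"
    by (rule one_shot_code[OF fin bins[OF m(1)] bins[OF m(2)] bins[OF m(3)] bins[OF m(4)] pos])
  define e where "e xs ys = (enc (zip xs ys), hx xs, hy ys)" for xs ys
  have zip: "zip (map source_x zs) (map source_y zs) = map source_xy zs"
    for zs :: "('x \<times> 'y \<times> 'u \<times> 'v) list"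
    by (induction zs) (simp_all add: source_xy_def)
  have kernel: "(\<lambda>zs. block_kernel k (map source_xy zs)) = block_kernel K"
    by (simp add: K_def comp_def)
  have "is_code n m0 m1 m2 e"
    using ranges unfolding is_code_def e_def image_subset_iff by simp
  with error show ?thesis
    unfolding kernel receiver_bound_joint_replicate
    by (intro that[of e dx dy]) (simp_all add: err_x_eq_prob err_y_eq_prob e_def zip Jn_def N_def)
qed

lemma eventually_exists_block_code_exponents:
  fixes Q :: "('x::finite \<times> 'y::finite \<times> 'u::finite \<times> 'v::finite) pmf"
    and k :: "'x \<times> 'y \<Rightarrow> 'w::finite pmf"
  defines "K \<equiv> \<lambda>z. k (source_xy z)"
  defines "J \<equiv> joint_pmf Q K"
  assumes \<alpha>: "cent (pmf J) fst (\<lambda>j. side_u (snd j)) < \<alpha>"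
      "cent (pmf J) fst (\<lambda>j. side_v (snd j)) < \<alpha>" "\<alpha> < \<rho> + r0"
    and \<beta>: "\<rho> < \<beta>" "\<beta> < kernel_entropy Q K"
    and \<alpha>x: "cent (pmf J) (\<lambda>j. source_x (snd j)) (\<lambda>j. (fst j, side_u (snd j))) < \<alpha>x" "\<alpha>x < r1"
    and \<alpha>y: "cent (pmf J) (\<lambda>j. source_y (snd j)) (\<lambda>j. (fst j, side_v (snd j))) < \<alpha>y" "\<alpha>y < r2"
    and \<epsilon>: "0 < \<epsilon>"
  shows "\<forall>\<^sub>F n in sequentially. \<exists>e dx dy.
    is_code n (codebook_size r0 n) (codebook_size r1 n) (codebook_size r2 n) e
      \<and> err_x Q n e dx + err_y Q n e dy \<le> \<epsilon>"
proof -
  let ?size = "\<lambda>r n. real (codebook_size r n)"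
  let ?bound = "\<lambda>n. receiver_bound (replicate_pmf n J)
      (map fst) (map (\<lambda>j. source_x (snd j))) (map (\<lambda>j. side_u (snd j)))
      (2 powr (- real n * \<alpha>)) (2 powr (- real n * \<alpha>x)) (?size \<rho> n * ?size r0 n) (?size r1 n)
    + receiver_bound (replicate_pmf n J)
      (map fst) (map (\<lambda>j. source_y (snd j))) (map (\<lambda>j. side_v (snd j)))
      (2 powr (- real n * \<alpha>)) (2 powr (- real n * \<alpha>y)) (?size \<rho> n * ?size r0 n) (?size r2 n)
    + 2 * bias_bound (replicate_pmf n Q) (block_kernel K) (2 powr (- real n * \<beta>)) (?size \<rho> n)"
  have sizes: "2 powr (real n * (\<rho> + r0)) \<le> ?size \<rho> n * ?size r0 n" for n
    unfolding distrib_left powr_add by (intro mult_mono codebook_size_bounds) auto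
  have "?bound \<longlonglongrightarrow> 0 + 0 + 2 * 0"
    by (intro tendsto_add tendsto_mult_left bias_bound_replicate_tendsto_0 \<beta>
        receiver_bound_replicate_tendsto_0[OF \<alpha>(1,3) sizes \<alpha>x codebook_size_bounds(1)]
        receiver_bound_replicate_tendsto_0[OF \<alpha>(2,3) sizes \<alpha>y codebook_size_bounds(1)]) simp_all
  then have "\<forall>\<^sub>F n in sequentially. ?bound n < \<epsilon>"
    using \<epsilon> by (intro order_tendstoD(2)) simp_all
  then show ?thesis
  proof eventually_elim
    case (elim n)
    have pos: "0 < (2 :: real) powr a" for a
      by simp
    obtain e dx dy where code: "is_code n (codebook_size r0 n) (codebook_size r1 n) (codebook_size r2 n) e"
      and error: "err_x Q n e dx + err_y Q n e dy \<le> ?bound n"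
      unfolding J_def K_def
      by (rule exists_block_code[OF codebook_size_pos codebook_size_pos codebook_size_pos
            codebook_size_pos pos pos pos less_imp_le[OF pos]])
    have "err_x Q n e dx + err_y Q n e dy \<le> \<epsilon>"
      using error elim by linarith
    with code show ?case by blast
  qed
qed

lemma eventually_exists_block_code:
  fixes Q :: "('x::finite \<times> 'y::finite \<times> 'u::finite \<times> 'v::finite) pmf"
    and k :: "'x \<times> 'y \<Rightarrow> 'w::finite pmf"
  defines "K \<equiv> \<lambda>z. k (source_xy z)"
  defines "J \<equiv> joint_pmf Q K"
  assumes r0: "cent (pmf J) fst (\<lambda>j. side_u (snd j)) < kernel_entropy Q K + r0"
      "cent (pmf J) fst (\<lambda>j. side_v (snd j)) < kernel_entropy Q K + r0"
    and r1: "cent (pmf J) (\<lambda>j. source_x (snd j)) (\<lambda>j. (fst j, side_u (snd j))) < r1"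
    and r2: "cent (pmf J) (\<lambda>j. source_y (snd j)) (\<lambda>j. (fst j, side_v (snd j))) < r2"
    and \<epsilon>: "0 < \<epsilon>"
  shows "\<forall>\<^sub>F n in sequentially. \<exists>e dx dy.
    is_code n (codebook_size r0 n) (codebook_size r1 n) (codebook_size r2 n) e
      \<and> err_x Q n e dx + err_y Q n e dy \<le> \<epsilon>"
proof -
  let ?Hu = "cent (pmf J) fst (\<lambda>j. side_u (snd j))" and ?Hv = "cent (pmf J) fst (\<lambda>j. side_v (snd j))"
  have "max ?Hu ?Hv < kernel_entropy Q K + r0"
    using r0 by simp
  then obtain \<alpha> where "max ?Hu ?Hv < \<alpha>" "\<alpha> < kernel_entropy Q K + r0"
    using dense by blast
  then have \<alpha>: "?Hu < \<alpha>" "?Hv < \<alpha>" "\<alpha> - r0 < kernel_entropy Q K"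
    by simp_all
  then obtain \<rho> where \<rho>: "\<alpha> - r0 < \<rho>" "\<rho> < kernel_entropy Q K"
    using dense by blast
  obtain \<beta> where \<beta>: "\<rho> < \<beta>" "\<beta> < kernel_entropy Q K"
    using dense[OF \<rho>(2)] by blast
  obtain \<alpha>x where \<alpha>x: "cent (pmf J) (\<lambda>j. source_x (snd j)) (\<lambda>j. (fst j, side_u (snd j))) < \<alpha>x" "\<alpha>x < r1"
    using dense[OF r1] by blast
  obtain \<alpha>y where \<alpha>y: "cent (pmf J) (\<lambda>j. source_y (snd j)) (\<lambda>j. (fst j, side_v (snd j))) < \<alpha>y" "\<alpha>y < r2"
    using dense[OF r2] by blast
  show ?thesis
    using \<alpha>(1,2) \<rho>(1) \<beta> \<alpha>x \<alpha>y \<epsilon> unfolding J_def K_def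
    by (intro eventually_exists_block_code_exponents) (simp_all add: diff_less_eq)
qed

lemma log_codebook_size_le_rate:
  assumes "0 \<le> R" and "0 < \<epsilon>" and "2 / \<epsilon> \<le> real n"
  shows "log 2 (real (codebook_size (R + \<epsilon> / 2) n)) / real n \<le> R + \<epsilon>"
proof -
  have n: "0 < real n"
    using assms by (meson divide_pos_pos less_le_trans zero_less_numeral)
  then have "log 2 (real (codebook_size (R + \<epsilon> / 2) n)) / real n \<le> R + \<epsilon> / 2 + 1 / real n"
    using assms by (intro log_codebook_size_le) auto
  also have "1 / real n \<le> \<epsilon> / 2"
    using assms n by (simp add: field_simps)
  finally show ?thesis by simp
qed

lemma Rin_p_subset_achievable:
  fixes Q :: "('x::finite \<times> 'y::finite \<times> 'u::finite \<times> 'v::finite) pmf"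
    and c :: "'x \<Rightarrow> 'y \<Rightarrow> 'w::finite \<Rightarrow> real"
  assumes c: "c \<in> cond_kernels"
  shows "Rin_p (joint_p c Q) \<subseteq> {R. achievable Q R}"
proof clarify
  fix R0 R1 R2 assume R: "(R0, R1, R2) \<in> Rin_p (joint_p c Q)"
  let ?K = "\<lambda>z. kernel_pmf c (source_xy z)"
  let ?J = "joint_pmf Q ?K"
  have R0: "cmi (pmf ?J) (\<lambda>j. source_xy (snd j)) fst (\<lambda>j. side_u (snd j)) \<le> R0"
      "cmi (pmf ?J) (\<lambda>j. source_xy (snd j)) fst (\<lambda>j. side_v (snd j)) \<le> R0"
    and R12: "cent (pmf ?J) (\<lambda>j. source_x (snd j)) (\<lambda>j. (fst j, side_u (snd j))) \<le> R1"
      "cent (pmf ?J) (\<lambda>j. source_y (snd j)) (\<lambda>j. (fst j, side_v (snd j))) \<le> R2"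
    using R by (simp_all add: Rin_p_def joint_p_eq_pmf[OF c] source_defs case_prod_unfold)
  have nonneg: "0 \<le> R0" "0 \<le> R1" "0 \<le> R2"
    using order_trans[OF cmi_nonneg R0(1)] order_trans[OF cent_nonneg R12(1)]
      order_trans[OF cent_nonneg R12(2)] .
  show "achievable Q (R0, R1, R2)"
    unfolding achievable_iff
  proof (intro allI impI)
    fix \<epsilon> :: real assume \<epsilon>: "0 < \<epsilon>"
    let ?size = "\<lambda>R. codebook_size (R + \<epsilon> / 2)"
    have "\<forall>\<^sub>F n in sequentially. \<exists>e dx dy. is_code n (?size R0 n) (?size R1 n) (?size R2 n) e
        \<and> err_x Q n e dx + err_y Q n e dy \<le> \<epsilon>"
      using R0[unfolded cmi_joint_pmf] R12 \<epsilon>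
      by (intro eventually_exists_block_code[where k = "kernel_pmf c"]) simp_all
    moreover have "\<forall>\<^sub>F n in sequentially. 2 / \<epsilon> \<le> real n"
      using filterlim_real_sequentially by (simp add: filterlim_at_top)
    ultimately show "\<forall>\<^sub>F n in sequentially. has_code Q n \<epsilon> (R0, R1, R2)"
    proof eventually_elim
      case (elim n)
      then obtain e dx dy where "is_code n (?size R0 n) (?size R1 n) (?size R2 n) e"
        and "max (err_x Q n e dx) (err_y Q n e dy) \<le> \<epsilon>"
        using max_err_le_sum order_trans by blast
      then show ?case
        unfolding has_code_def prod.case
        using log_codebook_size_le_rate[OF nonneg(1) \<epsilon> elim(2)]
          log_codebook_size_le_rate[OF nonneg(2) \<epsilon> elim(2)]
          log_codebook_size_le_rate[OF nonneg(3) \<epsilon> elim(2)] by blast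
    qed
  qed
qed

theorem theorem2:
  fixes Q :: "('x::finite \<times> 'y::finite \<times> 'u::finite \<times> 'v::finite) pmf"
  assumes "CARD('w::finite) \<le> CARD('x) * CARD('y) + 3"
  shows "closure (\<Union>c \<in> (cond_kernels :: ('x \<Rightarrow> 'y \<Rightarrow> 'w \<Rightarrow> real) set). Rin_p (joint_p c Q))
           \<subseteq> {R. achievable Q R}"
proof (rule closure_minimal[OF _ closed_achievable])
  show "(\<Union>c \<in> (cond_kernels :: ('x \<Rightarrow> 'y \<Rightarrow> 'w \<Rightarrow> real) set). Rin_p (joint_p c Q)) \<subseteq> {R. achievable Q R}"
    using Rin_p_subset_achievable by (intro UN_least)
qed

end
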